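(* Let $X$ be a topological space and $K_0\in\mathcal K(X)$ a kernel of hyperbolic type with critical dimension $\kappa_{K_0}<\infty$. If its critical exponent satisfies $t_{K_0}<\infty$, then the critical dimension function $K\mapsto\kappa_K$ on $\mathcal K(X)$ is lower semi-continuous at $K_0$.
   Context: A kernel on $X$ is a continuous symmetric function $K\colon X\times X\to\mathbb R$; it is of hyperbolic type when it is nonnegative, $K(x,x)=1$ for all $x$, and $\sum_{i,j=1}^n\lambda_i\lambda_jK(x_i,x_j)\le\big(\sum_{k=1}^n\lambda_kK(x_0,x_k)\big)^2$ for all $n$, $x_0,\dots,x_n\in X$, $\lambda\in\mathbb R^n$. $\mathcal K(X)$ is the set of such kernels with the topology of pointwise convergence. $\mathbf H^\kappa$ is the real algebraic hyperbolic space of dimension $\kappa$: in $\mathbb R\oplus\ell^2(\kappa)$ with the form $\langle x,y\rangle=x_0y_0-\sum_{i>0}x_iy_i$, it is $\{x:\langle x,x\rangle=1,\ x_0>0\}$ with $\cosh \mathbf d(x,y)=\langle x,y\rangle$. For every $K\in\mathcal K(X)$ there is a continuous $f\colon X\to\mathbf H^\kappa$ with total image (not contained in a proper closed totally geodesic subspace) such that $K(x,y)=\cosh\mathbf d(f(x),f(y))$, unique up to isometry; $\dim(K)\in\mathbb N\cup\{\infty\}$ denotes this $\kappa$ (with $\infty$ for infinite $\kappa$). The critical exponent $t_K\in[1,\infty]$ is the supremum of $t\in[1,\infty)$ such that $K^t\in\mathcal K(X)$; if $t_K<\infty$ then $K^{t_K}\in\mathcal K(X)$ and the critical dimension is $\kappa_K=\dim(K^{t_K})$.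 If $t_K=\infty$ (equivalently $K=\exp d(f(\cdot),f(\cdot))$ for a function $f$ from $X$ to a real tree), $\kappa_K$ is the common value of $\dim(K^t)$, $t>0$. *)

theory Defs
  imports "HOL-Analysis.Analysis"
begin

definition hyperbolic_kernel :: "('a::topological_space \<Rightarrow> 'a \<Rightarrow> real) \<Rightarrow> bool" where
  "hyperbolic_kernel K \<longleftrightarrow>
     continuous_on UNIV (\<lambda>(x, y). K x y) \<and>
     (\<forall>x y. K x y = K y x) \<and>
     (\<forall>x y. 0 \<le> K x y) \<and>
     (\<forall>x. K x x = 1) \<and>
     (\<forall>(n::nat) (x::nat \<Rightarrow> 'a) (c::nat \<Rightarrow> real).
        (\<Sum>i=1..n. \<Sum>j=1..n. c i * c j * K (x i) (x j)) \<le> (\<Sum>k=1..n. c k * K (x 0) (x k))\<^sup>2)"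

text \<open>The topology of pointwise convergence on this set is the one induced by the
  \<^class>\<open>topological_space\<close> instance of the function type, i.e. the (iterated) product topology.\<close>

definition hyperbolic_kernels :: "('a::topological_space \<Rightarrow> 'a \<Rightarrow> real) set" where
  "hyperbolic_kernels = {K. hyperbolic_kernel K}"

definition kernel_powr :: "('a \<Rightarrow> 'a \<Rightarrow> real) \<Rightarrow> real \<Rightarrow> ('a \<Rightarrow> 'a \<Rightarrow> real)" where
  "kernel_powr K t = (\<lambda>x y. K x y powr t)"

text \<open>The cardinal \<open>\<kappa>\<close> is represented by an index set \<open>I\<close>.  A vector of \<open>\<real> \<oplus> \<ell>\<^sup>2(I)\<close> is a pair
  whose second component is a function that vanishes off \<open>I\<close>.\<close>

definition ell2 :: "'i set \<Rightarrow> ('i \<Rightarrow> real) set" where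
  "ell2 I = {v. (\<forall>i. i \<notin> I \<longrightarrow> v i = 0) \<and> (\<lambda>i. (v i)\<^sup>2) summable_on I}"

definition lorentz_form :: "'i set \<Rightarrow> real \<times> ('i \<Rightarrow> real) \<Rightarrow> real \<times> ('i \<Rightarrow> real) \<Rightarrow> real" where
  "lorentz_form I x y = fst x * fst y - (\<Sum>\<^sub>\<infinity>i\<in>I. snd x i * snd y i)"

definition hyp_space :: "'i set \<Rightarrow> (real \<times> ('i \<Rightarrow> real)) set" where
  "hyp_space I = {x. snd x \<in> ell2 I \<and> lorentz_form I x x = 1 \<and> fst x > 0}"

definition hyp_dist :: "'i set \<Rightarrow> real \<times> ('i \<Rightarrow> real) \<Rightarrow> real \<times> ('i \<Rightarrow> real) \<Rightarrow> real" where
  "hyp_dist I x y = arcosh (lorentz_form I x y)"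

text \<open>Topological notions refer to the metric \<^const>\<open>hyp_dist\<close>, not to the
  product topology of the ambient function type.\<close>

definition hyp_closed :: "'i set \<Rightarrow> (real \<times> ('i \<Rightarrow> real)) set \<Rightarrow> bool" where
  "hyp_closed I S \<longleftrightarrow>
     S \<subseteq> hyp_space I \<and> (\<forall>p\<in>hyp_space I. (\<forall>e>0. \<exists>q\<in>S. hyp_dist I p q < e) \<longrightarrow> p \<in> S)"

definition hyp_continuous :: "'i set \<Rightarrow> ('a::topological_space \<Rightarrow> real \<times> ('i \<Rightarrow> real)) \<Rightarrow> bool" where
  "hyp_continuous I f \<longleftrightarrow>
     range f \<subseteq> hyp_space I \<and> (\<forall>x. \<forall>e>0. \<forall>\<^sub>F y in nhds x. hyp_dist I (f x) (f y) < e)"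

definition geodesic_line :: "'i set \<Rightarrow> (real \<Rightarrow> real \<times> ('i \<Rightarrow> real)) \<Rightarrow> bool" where
  "geodesic_line I g \<longleftrightarrow>
     range g \<subseteq> hyp_space I \<and> (\<forall>s t. hyp_dist I (g s) (g t) = \<bar>s - t\<bar>)"

text \<open>A subset is totally geodesic if it contains the entire geodesic line through any two
  distinct points of it; single points qualify.\<close>

definition totally_geodesic :: "'i set \<Rightarrow> (real \<times> ('i \<Rightarrow> real)) set \<Rightarrow> bool" where
  "totally_geodesic I S \<longleftrightarrow>
     S \<subseteq> hyp_space I \<and>
     (\<forall>g s t. geodesic_line I g \<and> s \<noteq> t \<and> g s \<in> S \<and> g t \<in> S \<longrightarrow> range g \<subseteq> S)"

definition hyp_total :: "'i set \<Rightarrow> (real \<times> ('i \<Rightarrow> real)) set \<Rightarrow> bool" where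
  "hyp_total I A \<longleftrightarrow>
     \<not> (\<exists>S. hyp_closed I S \<and> totally_geodesic I S \<and> S \<noteq> hyp_space I \<and> A \<subseteq> S)"

definition represents_kernel ::
  "'i set \<Rightarrow> ('a::topological_space \<Rightarrow> real \<times> ('i \<Rightarrow> real)) \<Rightarrow> ('a \<Rightarrow> 'a \<Rightarrow> real) \<Rightarrow> bool" where
  "represents_kernel I f K \<longleftrightarrow>
     hyp_continuous I f \<and> hyp_total I (range f) \<and>
     (\<forall>x y. K x y = cosh (hyp_dist I (f x) (f y)))"

definition ecard :: "'i set \<Rightarrow> enat" where
  "ecard I = (if finite I then enat (card I) else \<infinity>)"

text \<open>For a kernel of hyperbolic type the set below is a singleton, by existence and uniqueness
  of the representation, so the infimum is its unique element.  Subsets of \<open>'a + nat\<close> suffice as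
  index sets: they realise every finite cardinality, and a total image of the space \<open>'a\<close>
  forces \<open>\<kappa>\<close> to be at most the cardinality of \<open>'a + nat\<close>.\<close>

definition kernel_dim :: "('a::topological_space \<Rightarrow> 'a \<Rightarrow> real) \<Rightarrow> enat" where
  "kernel_dim K = Inf {ecard I | I :: ('a + nat) set. \<exists>f. represents_kernel I f K}"

definition critical_exponent :: "('a::topological_space \<Rightarrow> 'a \<Rightarrow> real) \<Rightarrow> ereal" where
  "critical_exponent K = Sup {ereal t | t. 1 \<le> t \<and> kernel_powr K t \<in> hyperbolic_kernels}"

definition critical_dim :: "('a::topological_space \<Rightarrow> 'a \<Rightarrow> real) \<Rightarrow> enat" where
  "critical_dim K =
     (if critical_exponent K < \<infinity>
      then kernel_dim (kernel_powr K (real_of_ereal (critical_exponent K)))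
      else (THE k. \<forall>t>0. kernel_dim (kernel_powr K t) = k))"

definition lower_semicontinuous_at ::
  "'a::topological_space set \<Rightarrow> ('a \<Rightarrow> 'b::linorder) \<Rightarrow> 'a \<Rightarrow> bool" where
  "lower_semicontinuous_at S f x0 \<longleftrightarrow> (\<forall>c<f x0. \<forall>\<^sub>F x in at x0 within S. c < f x)"

end

theory Submission imports Defs begin

text \<open>
  Put \<open>H = K\<^sub>0\<^bsup>t\<^sub>0\<^esup>\<close>, where \<open>t\<^sub>0\<close> is the critical exponent, and let \<open>d = dim H\<close>. Totality
  yields \<open>d + 1\<close> points whose Gram matrix with respect to \<open>H\<close> is nondegenerate. For \<open>t < t\<^sub>0\<close> the
  Gram matrix of \<open>K\<^sub>0\<^sup>t\<close> on these points is nondegenerate as well, because it is a power with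
  exponent \<open>s < 1\<close> of the former: after normalisation by a base point the defect is
  \<open>1 - (1 - N)\<^sup>s\<close> with \<open>N\<close> positive semidefinite, whose binomial series has only positive
  coefficients, so by Schur's theorem a null vector of it is a null vector of all powers of \<open>N\<close>.

  Nondegeneracy is an open condition, so it persists for \<open>K\<^sup>t\<close> with \<open>K\<close> near \<open>K\<^sub>0\<close> and all
  \<open>t\<close> in some interval \<open>[1, s]\<close> with \<open>s > t\<^sub>0\<close>. Since \<open>K\<^sub>0\<^sup>s\<close> violates the hyperbolic
  inequality strictly, so does \<open>K\<^sup>s\<close> for \<open>K\<close> near \<open>K\<^sub>0\<close>; as exponents below 1 preserve
  hyperbolic type, the critical exponent of \<open>K\<close> lies in \<open>[1, s]\<close>. A nondegenerate Gram matrix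
  on \<open>d + 1\<close> points forces dimension at least \<open>d\<close>.
\<close>

section \<open>Positive semidefinite matrices\<close>

lemma finite_obtains_argmax:
  fixes f :: "'i \<Rightarrow> 'b::linorder"
  assumes "finite S" "S \<noteq> {}"
  obtains m where "m \<in> S" "\<And>i. i \<in> S \<Longrightarrow> f i \<le> f m"
proof -
  have "Max (f ` S) \<in> f ` S" using assms by simp
  then obtain m where "m \<in> S" "Max (f ` S) = f m" by blast
  then show thesis using that Max_ge[of "f ` S"] assms by (metis finite_imageI imageI)
qed

definition psd_on :: "'i set \<Rightarrow> ('i \<Rightarrow> 'i \<Rightarrow> real) \<Rightarrow> bool" where
  "psd_on S A \<longleftrightarrow>
     (\<forall>i\<in>S. \<forall>j\<in>S. A i j = A j i) \<and> (\<forall>c. 0 \<le> (\<Sum>i\<in>S. \<Sum>j\<in>S. c i * c j * A i j))"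

lemma psd_onD:
  "psd_on S A \<Longrightarrow> i \<in> S \<Longrightarrow> j \<in> S \<Longrightarrow> A i j = A j i"
  "psd_on S A \<Longrightarrow> 0 \<le> (\<Sum>i\<in>S. \<Sum>j\<in>S. c i * c j * A i j)"
  by (auto simp: psd_on_def)

lemma psd_on_subset:
  assumes "psd_on S A" "T \<subseteq> S" "finite S"
  shows "psd_on T A"
proof -
  have "0 \<le> (\<Sum>i\<in>T. \<Sum>j\<in>T. c i * c j * A i j)" for c
  proof -
    let ?c = "\<lambda>i. if i \<in> T then c i else 0"
    have "(\<Sum>i\<in>S. \<Sum>j\<in>S. ?c i * ?c j * A i j) = (\<Sum>i\<in>T. \<Sum>j\<in>S. ?c i * ?c j * A i j)"
      using assms by (intro sum.mono_neutral_right) auto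
    also have "\<dots> = (\<Sum>i\<in>T. \<Sum>j\<in>T. ?c i * ?c j * A i j)"
      using assms by (intro sum.cong refl sum.mono_neutral_right) auto
    also have "\<dots> = (\<Sum>i\<in>T. \<Sum>j\<in>T. c i * c j * A i j)"
      by (intro sum.cong refl) auto
    finally show ?thesis using psd_onD(2)[OF assms(1), of ?c] by simp
  qed
  then show ?thesis using assms(1,2) unfolding psd_on_def by blast
qed

lemma psd_on_diag:
  assumes "psd_on S A" "i \<in> S" "finite S"
  shows "0 \<le> A i i"
  using psd_onD(2)[OF psd_on_subset[OF assms(1), of "{i}"], of "\<lambda>_. 1"] assms by simp

lemma psd_on_pair:
  assumes "psd_on S A" "i \<in> S" "j \<in> S" "finite S"
  shows "2 * \<bar>A i j\<bar> \<le> A i i + A j j"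
proof (cases "i = j")
  case True
  then show ?thesis using psd_on_diag[OF assms(1,2,4)] by simp
next
  case False
  have p: "psd_on {i, j} A" using psd_on_subset[OF assms(1)] assms by simp
  have "0 \<le> A i i + A j j + 2 * A i j"
    using psd_onD(2)[OF p, of "\<lambda>_. 1"] psd_onD(1)[OF p, of i j] False by simp
  moreover have "0 \<le> A i i + A j j - 2 * A i j"
    using psd_onD(2)[OF p, of "\<lambda>k. if k = i then 1 else - 1"] psd_onD(1)[OF p, of i j] False
    by simp
  ultimately show ?thesis by linarith
qed

text \<open>With \<open>A i i = 0\<close> the form on \<open>{i, j}\<close> is affine in the
  coefficient of \<open>i\<close>; being bounded below, it has slope 0.\<close>

lemma psd_on_zero_diag:
  assumes "psd_on S A" "i \<in> S" "j \<in> S" "finite S" "A i i = 0"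
  shows "A i j = 0"
proof (cases "i = j")
  case False
  have p: "psd_on {i, j} A" using psd_on_subset[OF assms(1)] assms by simp
  have q: "0 \<le> A j j + 2 * x * A i j" for x
    using psd_onD(2)[OF p, of "\<lambda>k. if k = i then x else 1"] psd_onD(1)[OF p, of i j] False assms(5)
    by (simp add: algebra_simps)
  show ?thesis
  proof (rule ccontr)
    assume "A i j \<noteq> 0"
    then have "A j j + 2 * (- (A j j + 1) / (2 * A i j)) * A i j = - 1" by (simp add: field_simps)
    with q[of "- (A j j + 1) / (2 * A i j)"] show False by linarith
  qed
qed (use assms in simp)

text \<open>Cholesky factorisation by induction on \<open>S\<close>: the row of a new index
  \<open>a\<close> is split off as a rank one term, and the Schur complement \<open>B\<close> stays
  positive semidefinite. If \<open>A a a = 0\<close>, that row vanishes, so division by zero, with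
  value 0, does no harm.\<close>

lemma psd_on_gram:
  assumes "finite S" "psd_on S A"
  shows "\<exists>V :: nat \<Rightarrow> 'i \<Rightarrow> real. \<forall>i\<in>S. \<forall>j\<in>S. A i j = (\<Sum>k<card S. V k i * V k j)"
  using assms
proof (induction S arbitrary: A rule: finite_induct)
  case empty
  then show ?case by simp
next
  case (insert a S)
  let ?T = "insert a S"
  define B where "B i j = A i j - A a i * A a j / A a a" for i j
  have sym: "A i j = A j i" if "i \<in> ?T" "j \<in> ?T" for i j
    using psd_onD(1)[OF insert.prems] that by blast
  have d: "0 \<le> A a a" using psd_on_diag[OF insert.prems] insert.hyps by simp
  have z: "A a i = 0" if "A a a = 0" "i \<in> ?T" for i
    using psd_on_zero_diag[OF insert.prems, of a i] that insert.hyps by simp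
  have "psd_on S B"
    unfolding psd_on_def
  proof (intro conjI ballI allI)
    fix i j assume "i \<in> S" "j \<in> S"
    then show "B i j = B j i" using sym[of i j] by (simp add: B_def)
  next
    fix c :: "'i \<Rightarrow> real"
    define L where "L = (\<Sum>i\<in>S. c i * A a i)"
    \<comment> \<open>The coefficient at \<open>a\<close> minimises the form of \<open>A\<close>,
      whose value at \<open>c'\<close> is then the form of \<open>B\<close> at
      \<open>c\<close>.\<close>
    define c' where "c' i = (if i = a then - L / A a a else c i)" for i
    define Q where "Q = (\<Sum>i\<in>S. \<Sum>j\<in>S. c i * c j * A i j)"
    have Q': "(\<Sum>i\<in>S. \<Sum>j\<in>S. c' i * c' j * A i j) = Q"
      unfolding Q_def using insert.hyps by (intro sum.cong refl) (auto simp: c'_def)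
    have r: "(\<Sum>j\<in>S. c' a * c' j * A a j) = c' a * L"
      unfolding L_def sum_distrib_left
      using insert.hyps by (intro sum.cong refl) (auto simp: c'_def)
    have r': "(\<Sum>i\<in>S. c' i * c' a * A i a) = c' a * L"
      unfolding L_def sum_distrib_left
      using insert.hyps sym by (intro sum.cong refl) (auto simp: c'_def)
    have e: "(\<Sum>i\<in>?T. \<Sum>j\<in>?T. c' i * c' j * A i j) = c' a * c' a * A a a + 2 * (c' a * L) + Q"
      using insert.hyps Q' r r' by (simp add: sum.distrib)
    have L0: "L = 0" if "A a a = 0" using z[OF that] by (simp add: L_def)
    have "c' a * c' a * A a a + 2 * (c' a * L) + Q = Q - L * L / A a a"
      using L0 by (cases "A a a = 0") (auto simp: c'_def field_simps)
    also have "\<dots> = (\<Sum>i\<in>S. \<Sum>j\<in>S. c i * c j * B i j)"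
    proof -
      have "L * L / A a a = (\<Sum>i\<in>S. \<Sum>j\<in>S. c i * c j * (A a i * A a j / A a a))"
        unfolding L_def sum_product sum_divide_distrib by (intro sum.cong refl) simp
      then show ?thesis
        by (simp add: Q_def B_def sum_subtractf right_diff_distrib)
    qed
    finally show "0 \<le> (\<Sum>i\<in>S. \<Sum>j\<in>S. c i * c j * B i j)"
      using psd_onD(2)[OF insert.prems, of c'] e by simp
  qed
  from insert.IH[OF this] obtain V where
    V: "\<forall>i\<in>S. \<forall>j\<in>S. B i j = (\<Sum>k<card S. V k i * V k j)" by blast
  \<comment> \<open>The new coordinate \<open>card S\<close> carries the rank one term; the older
    coordinates vanish at \<open>a\<close>.\<close>
  define W :: "nat \<Rightarrow> 'i \<Rightarrow> real" where
    "W k i = (if k = card S then A a i / sqrt (A a a) else if i = a then 0 else V k i)" for k i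
  have "A i j = (\<Sum>k<card ?T. W k i * W k j)" if ij: "i \<in> ?T" "j \<in> ?T" for i j
  proof -
    have "(\<Sum>k<card ?T. W k i * W k j) =
        (\<Sum>k<card S. W k i * W k j) + W (card S) i * W (card S) j"
      using insert.hyps by simp
    also have "W (card S) i * W (card S) j = A a i * A a j / A a a"
      using d by (simp add: W_def)
    also have "(\<Sum>k<card S. W k i * W k j) = B i j"
    proof (cases "i = a \<or> j = a")
      case True
      then have "(\<Sum>k<card S. W k i * W k j) = 0" by (intro sum.neutral) (auto simp: W_def)
      moreover have "B i j = 0"
        using True z[of i] z[of j] sym[OF ij] ij by (cases "A a a = 0") (auto simp: B_def)
      ultimately show ?thesis by simp
    next
      case False
      then have "(\<Sum>k<card S. W k i * W k j) = (\<Sum>k<card S. V k i * V k j)"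
        by (intro sum.cong refl) (auto simp: W_def)
      then show ?thesis using V ij False by auto
    qed
    finally show ?thesis by (simp add: B_def)
  qed
  then show ?case by blast
qed

lemma gram_quadratic:
  fixes V :: "nat \<Rightarrow> 'i \<Rightarrow> real"
  shows "(\<Sum>i\<in>S. \<Sum>j\<in>S. c i * c j * (\<Sum>k<n. V k i * V k j)) = (\<Sum>k<n. (\<Sum>i\<in>S. c i * V k i)\<^sup>2)"
proof -
  have "(\<Sum>k<n. (\<Sum>i\<in>S. c i * V k i)\<^sup>2) = (\<Sum>k<n. \<Sum>i\<in>S. \<Sum>j\<in>S. c i * V k i * (c j * V k j))"
    by (simp add: power2_eq_square sum_product)
  also have "\<dots> = (\<Sum>i\<in>S. \<Sum>k<n. \<Sum>j\<in>S. c i * V k i * (c j * V k j))" by (rule sum.swap)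
  also have "\<dots> = (\<Sum>i\<in>S. \<Sum>j\<in>S. \<Sum>k<n. c i * V k i * (c j * V k j))"
    by (intro sum.cong refl sum.swap)
  finally show ?thesis by (simp add: sum_distrib_left algebra_simps)
qed

text \<open>A Gram factorisation turns the form into a sum of squares, each of which must
  vanish.\<close>

lemma psd_on_kernel:
  assumes "finite S" "psd_on S A" "(\<Sum>i\<in>S. \<Sum>j\<in>S. c i * c j * A i j) = 0" "m \<in> S"
  shows "(\<Sum>i\<in>S. c i * A i m) = 0"
proof -
  obtain V :: "nat \<Rightarrow> 'a \<Rightarrow> real" where V: "\<forall>i\<in>S. \<forall>j\<in>S. A i j = (\<Sum>k<card S. V k i * V k j)"
    using psd_on_gram[OF assms(1,2)] by blast
  have "(\<Sum>k<card S. (\<Sum>i\<in>S. c i * V k i)\<^sup>2) = 0"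
    using assms(3) V gram_quadratic[of c V "card S" S] by simp
  then have z: "(\<Sum>i\<in>S. c i * V k i) = 0" if "k < card S" for k
    using that by (simp add: sum_nonneg_eq_0_iff)
  have "(\<Sum>i\<in>S. c i * A i m) = (\<Sum>i\<in>S. \<Sum>k<card S. c i * V k i * V k m)"
    using V assms(4) by (simp add: sum_distrib_left mult.assoc)
  also have "\<dots> = (\<Sum>k<card S. \<Sum>i\<in>S. c i * V k i * V k m)" by (rule sum.swap)
  also have "\<dots> = 0" using z by (simp flip: sum_distrib_right)
  finally show ?thesis .
qed

text \<open>With \<open>A\<close> factored as a Gram matrix, the form of the product at
  \<open>c\<close> is the sum over \<open>k\<close> of the forms of \<open>B\<close> at
  \<open>c i * V k i\<close>.\<close>

lemma psd_on_Schur: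
  assumes "finite S" "psd_on S A" "psd_on S B"
  shows "psd_on S (\<lambda>i j. A i j * B i j)"
proof -
  obtain V :: "nat \<Rightarrow> 'a \<Rightarrow> real" where V: "\<forall>i\<in>S. \<forall>j\<in>S. A i j = (\<Sum>k<card S. V k i * V k j)"
    using psd_on_gram[OF assms(1,2)] by blast
  have "0 \<le> (\<Sum>i\<in>S. \<Sum>j\<in>S. c i * c j * (A i j * B i j))" for c
  proof -
    have "0 \<le> (\<Sum>k<card S. \<Sum>i\<in>S. \<Sum>j\<in>S. (c i * V k i) * (c j * V k j) * B i j)"
      by (intro sum_nonneg psd_onD(2)[OF assms(3)])
    also have "\<dots> = (\<Sum>i\<in>S. \<Sum>k<card S. \<Sum>j\<in>S. (c i * V k i) * (c j * V k j) * B i j)"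
      by (rule sum.swap)
    also have "\<dots> = (\<Sum>i\<in>S. \<Sum>j\<in>S. \<Sum>k<card S. (c i * V k i) * (c j * V k j) * B i j)"
      by (intro sum.cong refl sum.swap)
    also have "\<dots> = (\<Sum>i\<in>S. \<Sum>j\<in>S. c i * c j * (A i j * B i j))"
      using V by (intro sum.cong refl)
        (simp add: sum_distrib_left sum_distrib_right algebra_simps)
    finally show ?thesis .
  qed
  moreover have "A i j * B i j = A j i * B j i" if "i \<in> S" "j \<in> S" for i j
    using psd_onD(1)[OF assms(2) that] psd_onD(1)[OF assms(3) that] by simp
  ultimately show ?thesis by (simp add: psd_on_def)
qed

lemma psd_on_power:
  assumes "finite S" "psd_on S A"
  shows "psd_on S (\<lambda>i j. A i j ^ k)"
proof (induction k)
  case 0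
  have "(\<Sum>i\<in>S. \<Sum>j\<in>S. c i * c j) = (\<Sum>i\<in>S. c i)\<^sup>2" for c :: "'a \<Rightarrow> real"
    by (simp add: power2_eq_square sum_product)
  then show ?case by (simp add: psd_on_def)
next
  case (Suc k)
  then show ?case using psd_on_Schur[OF assms Suc] by simp
qed

section \<open>The binomial series of \<open>1 - (1 - x) powr s\<close>\<close>

lemma gbinomial_alternating:
  fixes s :: real
  assumes "0 < s" "s < 1"
  shows "(-1) ^ Suc k * (s gchoose Suc k) < 0"
proof (induction k)
  case 0
  then show ?case using assms by simp
next
  case (Suc k)
  \<comment> \<open>The ratio of consecutive terms is positive for \<open>s < 1\<close>, so all
    inherit the sign of the first, \<open>- s\<close>. Hence the series of
    \<open>1 - (1 - x) powr s\<close> has only positive coefficients.\<close>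
  have "(-1) ^ Suc (Suc k) * (s gchoose Suc (Suc k)) =
      ((-1) ^ Suc k * (s gchoose Suc k)) * ((real (Suc k) - s) / (real (Suc k) + 1))"
  proof -
    have "s gchoose Suc (Suc k) = (s gchoose Suc k) * ((s - real (Suc k)) / (real (Suc k) + 1))"
      using gbinomial_mult_1[of s "Suc k"] by (simp add: field_simps)
    then show ?thesis by (simp only:) (simp add: field_simps)
  qed
  also have "\<dots> < 0" by (rule mult_neg_pos[OF Suc]) (use assms in simp)
  finally show ?case .
qed

lemma one_minus_powr_sums:
  fixes s x :: real
  assumes "\<bar>x\<bar> < 1"
  shows "(\<lambda>k. - ((-1) ^ Suc k * (s gchoose Suc k)) * x ^ Suc k) sums (1 - (1 - x) powr s)"
proof -
  have "(\<lambda>n. (s gchoose n) * (- x) ^ n) sums (1 + - x) powr s"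
    using assms by (intro gen_binomial_real) simp
  then have "(\<lambda>n. (s gchoose Suc n) * (- x) ^ Suc n) sums ((1 - x) powr s - 1)"
    by (subst sums_Suc_iff) simp
  then have "(\<lambda>n. - ((s gchoose Suc n) * (- x) ^ Suc n)) sums - ((1 - x) powr s - 1)"
    by (rule sums_minus)
  moreover have "- ((s gchoose Suc n) * (- x) ^ Suc n) =
      - ((-1) ^ Suc n * (s gchoose Suc n)) * x ^ Suc n" for n
    by (subst power_minus) (simp only: mult_minus_left mult.left_commute mult.assoc)
  ultimately show ?thesis by (simp only: minus_diff_eq)
qed

section \<open>Powers of Gram matrices of hyperbolic type\<close>

text \<open>As \<open>k\<close> grows, the terms with ratio of modulus below 1 die out; the ratio 1
  occurs at \<open>m\<close> alone, so its coefficient is isolated in the limit.\<close>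

lemma power_sum_null:
  fixes r :: "'i \<Rightarrow> real"
  assumes "finite S" "m \<in> S" "r m = 1" "\<And>i. i \<in> S \<Longrightarrow> i \<noteq> m \<Longrightarrow> - 1 \<le> r i \<and> r i < 1"
    and "\<And>k. (\<Sum>i\<in>S. b i * r i ^ Suc k) = 0"
  shows "b m = 0"
proof -
  \<comment> \<open>Adding two consecutive power sums removes the oscillating terms with \<open>r i = - 1\<close>.\<close>
  have "(\<lambda>k. \<Sum>i\<in>S. b i * (r i ^ Suc k * (1 + r i))) \<longlonglongrightarrow> (\<Sum>i\<in>S. if i = m then 2 * b m else 0)"
  proof (intro tendsto_sum)
    fix i assume i: "i \<in> S"
    show "(\<lambda>k. b i * (r i ^ Suc k * (1 + r i))) \<longlonglongrightarrow> (if i = m then 2 * b m else 0)"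
    proof (cases "i = m \<or> r i = - 1")
      case True
      then show ?thesis using assms(3) by (auto simp: mult.commute)
    next
      case False
      then have "\<bar>r i\<bar> < 1" using assms(4)[OF i] by auto
      then have "(\<lambda>k. r i ^ Suc k) \<longlonglongrightarrow> 0"
        by (intro LIMSEQ_Suc LIMSEQ_power_zero) simp
      then have "(\<lambda>k. b i * (r i ^ Suc k * (1 + r i))) \<longlonglongrightarrow> b i * (0 * (1 + r i))"
        by (intro tendsto_intros)
      then show ?thesis using False by simp
    qed
  qed
  moreover have "(\<Sum>i\<in>S. b i * (r i ^ Suc k * (1 + r i))) = 0" for k
  proof -
    have "(\<Sum>i\<in>S. b i * (r i ^ Suc k * (1 + r i))) =
        (\<Sum>i\<in>S. b i * r i ^ Suc k) + (\<Sum>i\<in>S. b i * r i ^ Suc (Suc k))"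
      by (simp add: algebra_simps flip: sum.distrib)
    then show ?thesis by (simp only: assms(5) add_0_left)
  qed
  ultimately have "(\<lambda>k::nat. 0) \<longlonglongrightarrow> (\<Sum>i\<in>S. if i = m then 2 * b m else 0)"
    by (simp only:)
  then have "(\<Sum>i\<in>S. if i = m then 2 * b m else 0) = 0"
    by (simp only: tendsto_const_iff[OF sequentially_bot])
  then show ?thesis using assms(1,2) by simp
qed

text \<open>Row and column \<open>i\<close> of \<open>g i * g j - G i j\<close> are rescaled by
  \<open>1 / g i\<close>, which amounts to replacing \<open>c i\<close> by
  \<open>c i / g i\<close>.\<close>

lemma defect_psd:
  assumes "finite S" "\<And>i. i \<in> S \<Longrightarrow> 0 < g i"
    and "psd_on S (\<lambda>i j. g i * g j - G i j)"
  shows "psd_on S (\<lambda>i j. 1 - G i j / (g i * g j))"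
proof -
  have "0 \<le> (\<Sum>i\<in>S. \<Sum>j\<in>S. c i * c j * (1 - G i j / (g i * g j)))" for c
  proof -
    have "(\<Sum>i\<in>S. \<Sum>j\<in>S. c i * c j * (1 - G i j / (g i * g j))) =
        (\<Sum>i\<in>S. \<Sum>j\<in>S. (c i / g i) * (c j / g j) * (g i * g j - G i j))"
    proof (intro sum.cong refl)
      fix i j assume "i \<in> S" "j \<in> S"
      with assms(2)[of i] assms(2)[of j]
      show "c i * c j * (1 - G i j / (g i * g j)) = (c i / g i) * (c j / g j) * (g i * g j - G i j)"
        by (simp add: field_simps)
    qed
    also have "\<dots> \<ge> 0" by (rule psd_onD(2)[OF assms(3)])
    finally show ?thesis .
  qed
  moreover have "G i j = G j i" if "i \<in> S" "j \<in> S" for i j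
    using psd_onD(1)[OF assms(3) that] by (simp add: mult.commute)
  ultimately show ?thesis by (simp add: psd_on_def mult.commute)
qed

text \<open>A positive semidefinite matrix bounds each entry by the mean of two diagonal ones, and
  these are below 1 because \<open>G\<close> is positive. Hence the binomial series converges at
  every entry.\<close>

lemma defect_less_one:
  assumes "finite S" "\<And>i. i \<in> S \<Longrightarrow> 0 < g i"
    and "psd_on S (\<lambda>i j. g i * g j - G i j)"
    and "\<And>i j. i \<in> S \<Longrightarrow> j \<in> S \<Longrightarrow> 0 < G i j"
    and "i \<in> S" "j \<in> S"
  shows "\<bar>1 - G i j / (g i * g j)\<bar> < 1"
proof -
  have "2 * \<bar>1 - G i j / (g i * g j)\<bar> \<le> 1 - G i i / (g i * g i) + (1 - G j j / (g j * g j))"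
    using psd_on_pair[OF defect_psd[OF assms(1-3)] assms(5,6,1)] .
  moreover have "0 < G k k / (g k * g k)" if "k \<in> S" for k
    using assms(2)[OF that] assms(4)[OF that that] by simp
  ultimately show ?thesis using assms(5,6) by (smt (verit))
qed

text \<open>Put \<open>N i j = 1 - G i j / (g i * g j)\<close>. Then \<open>G i j powr s\<close>
  equals \<open>g i powr s * g j powr s * (1 - N i j) powr s\<close>, and the binomial series is
  summed entrywise, with the factors \<open>g i powr s\<close> absorbed into the
  coefficients.\<close>

lemma powr_defect_sums:
  fixes g :: "'i \<Rightarrow> real" and s :: real
  assumes "finite S" "\<And>i. i \<in> S \<Longrightarrow> 0 < g i"
    and "psd_on S (\<lambda>i j. g i * g j - G i j)"
    and "\<And>i j. i \<in> S \<Longrightarrow> j \<in> S \<Longrightarrow> 0 < G i j"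
  shows "(\<lambda>k. - ((-1) ^ Suc k * (s gchoose Suc k)) * (\<Sum>i\<in>S. \<Sum>j\<in>S.
            (c i * g i powr s) * (c j * g j powr s) * (1 - G i j / (g i * g j)) ^ Suc k))
         sums (\<Sum>i\<in>S. \<Sum>j\<in>S. c i * c j * (g i powr s * g j powr s - G i j powr s))"
proof -
  have "(\<lambda>k. \<Sum>i\<in>S. \<Sum>j\<in>S. (c i * g i powr s) * (c j * g j powr s) *
          (- ((-1) ^ Suc k * (s gchoose Suc k)) * (1 - G i j / (g i * g j)) ^ Suc k))
        sums (\<Sum>i\<in>S. \<Sum>j\<in>S. (c i * g i powr s) * (c j * g j powr s) *
          (1 - (1 - (1 - G i j / (g i * g j))) powr s))"
    by (intro sums_sum sums_mult one_minus_powr_sums defect_less_one[OF assms])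
  moreover have "(\<Sum>i\<in>S. \<Sum>j\<in>S. (c i * g i powr s) * (c j * g j powr s) *
          (1 - (1 - (1 - G i j / (g i * g j))) powr s)) =
      (\<Sum>i\<in>S. \<Sum>j\<in>S. c i * c j * (g i powr s * g j powr s - G i j powr s))"
  proof (intro sum.cong refl)
    fix i j assume ij: "i \<in> S" "j \<in> S"
    have "0 < g i" "0 < g j" "0 < G i j" using assms(2,4) ij by auto
    then show "(c i * g i powr s) * (c j * g j powr s) *
          (1 - (1 - (1 - G i j / (g i * g j))) powr s) =
        c i * c j * (g i powr s * g j powr s - G i j powr s)"
      by (simp add: powr_divide powr_mult field_simps)
  qed
  moreover have "(\<Sum>i\<in>S. \<Sum>j\<in>S. (c i * g i powr s) * (c j * g j powr s) *
          (a * (1 - G i j / (g i * g j)) ^ Suc k)) =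
      a * (\<Sum>i\<in>S. \<Sum>j\<in>S. (c i * g i powr s) * (c j * g j powr s) *
          (1 - G i j / (g i * g j)) ^ Suc k)" for a k
    unfolding sum_distrib_left by (intro sum.cong refl) (simp only: mult_ac)
  ultimately show ?thesis by (simp only:)
qed

text \<open>Each term of the series is a positive multiple of the form of an entrywise power of the
  defect.\<close>

lemma psd_on_powr_defect:
  assumes "finite S" "\<And>i. i \<in> S \<Longrightarrow> 0 < g i"
    and "psd_on S (\<lambda>i j. g i * g j - G i j)"
    and "\<And>i j. i \<in> S \<Longrightarrow> j \<in> S \<Longrightarrow> 0 < G i j"
    and s: "0 < s" "s < 1"
  shows "psd_on S (\<lambda>i j. g i powr s * g j powr s - G i j powr s)"
proof -
  have "0 \<le> (\<Sum>i\<in>S. \<Sum>j\<in>S. c i * c j * (g i powr s * g j powr s - G i j powr s))" for c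
  proof (rule sums_le[OF _ sums_zero powr_defect_sums[OF assms(1-4)]])
    fix k
    show "0 \<le> - ((-1) ^ Suc k * (s gchoose Suc k)) * (\<Sum>i\<in>S. \<Sum>j\<in>S.
            (c i * g i powr s) * (c j * g j powr s) * (1 - G i j / (g i * g j)) ^ Suc k)"
      using gbinomial_alternating[OF s, of k]
      by (intro mult_nonneg_nonneg psd_onD(2)[OF psd_on_power[OF assms(1) defect_psd[OF assms(1-3)]]])
        linarith
  qed
  moreover have "G i j = G j i" if "i \<in> S" "j \<in> S" for i j
    using psd_onD(1)[OF assms(3) that] by (simp add: mult.commute)
  ultimately show ?thesis by (simp add: psd_on_def mult.commute)
qed

text \<open>Nonnegative terms with sum 0 all vanish. The series coefficients are strictly positive,
  so the form of every entrywise power vanishes at the vector \<open>c i * g i powr s\<close>, which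
  therefore lies in its kernel.\<close>

lemma powr_defect_null:
  assumes "finite S" "\<And>i. i \<in> S \<Longrightarrow> 0 < g i"
    and "psd_on S (\<lambda>i j. g i * g j - G i j)"
    and "\<And>i j. i \<in> S \<Longrightarrow> j \<in> S \<Longrightarrow> 0 < G i j"
    and s: "0 < s" "s < 1"
    and z: "(\<Sum>i\<in>S. \<Sum>j\<in>S. c i * c j * (g i powr s * g j powr s - G i j powr s)) = 0"
    and m: "m \<in> S"
  shows "(\<Sum>i\<in>S. c i * g i powr s * (1 - G i m / (g i * g m)) ^ Suc k) = 0"
proof -
  let ?N = "\<lambda>i j. 1 - G i j / (g i * g j)"
  let ?q = "\<lambda>k. \<Sum>i\<in>S. \<Sum>j\<in>S. (c i * g i powr s) * (c j * g j powr s) * ?N i j ^ Suc k"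
  have P: "psd_on S (\<lambda>i j. ?N i j ^ Suc k)" for k
    by (rule psd_on_power[OF assms(1) defect_psd[OF assms(1-3)]])
  have q: "0 \<le> ?q k" for k by (rule psd_onD(2)[OF P])
  have b: "0 < - ((-1) ^ Suc k * (s gchoose Suc k))" for k
    using gbinomial_alternating[OF s, of k] by linarith
  have "(\<lambda>k. - ((-1) ^ Suc k * (s gchoose Suc k)) * ?q k) sums 0"
    using powr_defect_sums[OF assms(1-4), where c = c and s = s] z by simp
  moreover have "0 \<le> - ((-1) ^ Suc k * (s gchoose Suc k)) * ?q k" for k
    using b[of k] q[of k] by (intro mult_nonneg_nonneg) linarith+
  ultimately have "- ((-1) ^ Suc k * (s gchoose Suc k)) * ?q k = 0"
    using suminf_eq_zero_iff sums_iff by blast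
  then have "?q k = 0" using b[of k] by (simp only: mult_eq_0_iff) linarith
  from psd_on_kernel[OF assms(1) P this m] show ?thesis .
qed

definition nondegenerate_on :: "'i set \<Rightarrow> ('i \<Rightarrow> 'i \<Rightarrow> real) \<Rightarrow> bool" where
  "nondegenerate_on S A \<longleftrightarrow> (\<forall>c. (\<forall>i\<in>S. (\<Sum>j\<in>S. A i j * c j) = 0) \<longrightarrow> (\<forall>j\<in>S. c j = 0))"

text \<open>A null vector \<open>c\<close> yields, after rescaling, a null vector of all entrywise
  powers of the defect \<open>N\<close>. Letting the power grow isolates the index \<open>m\<close>
  with the largest \<open>N m m\<close> in the support and forces \<open>c m = 0\<close>. The
  condition \<open>1 < G i j\<close> keeps distinct indices apart as points.\<close>

lemma nondegenerate_on_powr: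
  fixes G :: "'i \<Rightarrow> 'i \<Rightarrow> real"
  assumes "finite S" "p \<in> S"
    and psd: "psd_on S (\<lambda>i j. G p i * G p j - G i j)"
    and diag: "\<And>i. i \<in> S \<Longrightarrow> G i i = 1"
    and off: "\<And>i j. i \<in> S \<Longrightarrow> j \<in> S \<Longrightarrow> i \<noteq> j \<Longrightarrow> 1 < G i j"
    and s: "0 < s" "s < 1"
  shows "nondegenerate_on S (\<lambda>i j. G i j powr s)"
  unfolding nondegenerate_on_def
proof (intro allI impI)
  fix c assume c: "\<forall>i\<in>S. (\<Sum>j\<in>S. G i j powr s * c j) = 0"
  have ge1: "1 \<le> G i j" if "i \<in> S" "j \<in> S" for i j
    using diag off that by (cases "i = j") (auto intro: less_imp_le)
  have pos: "0 < G i j" if "i \<in> S" "j \<in> S" for i j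
    using ge1[OF that] by linarith
  have sym: "G i j = G j i" if "i \<in> S" "j \<in> S" for i j
    using psd_onD(1)[OF psd that] by (simp add: mult.commute)
  note facts = assms(1) pos[OF assms(2)] psd pos s
  \<comment> \<open>Both parts on the right vanish: the square is that of row \<open>p\<close> of
    the null equations, the double sum combines all rows.\<close>
  have "(\<Sum>i\<in>S. \<Sum>j\<in>S. c i * c j * (G p i powr s * G p j powr s - G i j powr s)) =
      (\<Sum>i\<in>S. c i * G p i powr s) * (\<Sum>j\<in>S. c j * G p j powr s)
      - (\<Sum>i\<in>S. c i * (\<Sum>j\<in>S. G i j powr s * c j))"
    by (simp add: sum_product sum_subtractf sum_distrib_left algebra_simps)
  also have "\<dots> = 0" using c assms(2) by (simp add: mult.commute)
  finally have Q: "(\<Sum>i\<in>S. \<Sum>j\<in>S. c i * c j * (G p i powr s * G p j powr s - G i j powr s)) = 0" .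
  \<comment> \<open>Since \<open>G p p = 1\<close>, row and column \<open>p\<close> of
    \<open>N\<close> are zero; the coefficient at \<open>p\<close> is treated separately at the
    end.\<close>
  define N where "N = (\<lambda>i j. 1 - G i j / (G p i * G p j))"
  have null: "(\<Sum>i\<in>S. c i * G p i powr s * N i m ^ Suc k) = 0" if "m \<in> S" for m k
    unfolding N_def by (rule powr_defect_null[OF facts Q that])
  have pN: "psd_on S N" unfolding N_def by (rule defect_psd[OF facts(1-3)])
  have Nd: "0 < N m m" if "m \<in> S" "m \<noteq> p" for m
  proof -
    have "1 < G p m" using off[OF assms(2) that(1)] that(2) by simp
    then have "1 < G p m * G p m" by (simp add: less_1_mult)
    then show ?thesis using diag[OF that(1)] by (simp add: N_def)
  qed
  have c0: "c j = 0" if "j \<in> S" "j \<noteq> p" for j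
  proof (rule ccontr)
    assume "c j \<noteq> 0"
    define T where "T = {i\<in>S. i \<noteq> p \<and> c i \<noteq> 0}"
    have T: "finite T" "T \<noteq> {}" using assms(1) that \<open>c j \<noteq> 0\<close> by (auto simp: T_def)
    \<comment> \<open>This choice and \<open>2 * \<bar>N i m\<bar> \<le> N i i + N m m\<close> put
      every ratio \<open>N i m / N m m\<close> into \<open>[-1, 1]\<close>.\<close>
    obtain m where m: "m \<in> T" and max: "\<And>i. i \<in> T \<Longrightarrow> N i i \<le> N m m"
      using finite_obtains_argmax[OF T, of "\<lambda>i. N i i"] by blast
    have mS: "m \<in> S" "m \<noteq> p" "c m \<noteq> 0" using m by (auto simp: T_def)
    let ?r = "\<lambda>i. N i m / N m m"
    have d: "0 < N m m" by (rule Nd[OF mS(1,2)])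
    have "c m * G p m powr s = 0"
    proof (rule power_sum_null[OF T(1) m, of ?r])
      show "?r m = 1" using d by (intro divide_self) linarith
    next
      fix i assume i: "i \<in> T" "i \<noteq> m"
      then have iS: "i \<in> S" by (simp add: T_def)
      have b: "2 * \<bar>N i m\<bar> \<le> N i i + N m m" by (rule psd_on_pair[OF pN iS mS(1) assms(1)])
      \<comment> \<open>Equality would force \<open>N i i = N m m\<close>, hence
        \<open>G p i = G p m\<close> and then \<open>G i m = 1\<close>: the two points would
        coincide.\<close>
      have "N i m \<noteq> N m m"
      proof
        assume e: "N i m = N m m"
        then have "N i i = N m m" using b max[OF i(1)] d by linarith
        then have "inverse (G p i * G p i) = inverse (G p m * G p m)"
          by (simp add: N_def diag[OF iS] diag[OF mS(1)] inverse_eq_divide)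
        then have "(G p i)\<^sup>2 = (G p m)\<^sup>2"
          by (simp only: inverse_eq_iff_eq power2_eq_square)
        then have gg: "G p i = G p m"
          using pos[OF assms(2) iS] pos[OF assms(2) mS(1)]
          by (metis less_imp_le power2_eq_imp_eq)
        have "G i m / (G p m * G p m) = G m m / (G p m * G p m)"
          using e unfolding N_def gg by linarith
        then have "G i m = 1"
          using diag[OF mS(1)] pos[OF assms(2) mS(1)] by (simp add: divide_eq_eq)
        then show False using off[OF iS mS(1) i(2)] by simp
      qed
      moreover have "\<bar>N i m\<bar> \<le> N m m" using b max[OF i(1)] by linarith
      ultimately have "- N m m \<le> N i m" "N i m < N m m" by linarith+
      then show "- 1 \<le> ?r i \<and> ?r i < 1" using d
        by (simp add: le_divide_eq divide_less_eq)
    next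
      fix k
      have "(\<Sum>i\<in>T. c i * G p i powr s * N i m ^ Suc k) =
          (\<Sum>i\<in>S. c i * G p i powr s * N i m ^ Suc k)"
      proof (rule sum.mono_neutral_left)
        show "\<forall>i\<in>S - T. c i * G p i powr s * N i m ^ Suc k = 0"
        proof
          fix i assume "i \<in> S - T"
          then have "i = p \<or> c i = 0" by (auto simp: T_def)
          then show "c i * G p i powr s * N i m ^ Suc k = 0"
            using diag[OF assms(2)] pos[OF assms(2) mS(1)] by (auto simp: N_def)
        qed
      qed (auto simp: T_def assms(1))
      then have "(\<Sum>i\<in>T. c i * G p i powr s * N i m ^ Suc k) = 0" using null[OF mS(1)] by simp
      then have "(\<Sum>i\<in>T. c i * G p i powr s * N i m ^ Suc k) / N m m ^ Suc k = 0" by simp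
      then show "(\<Sum>i\<in>T. c i * G p i powr s * ?r i ^ Suc k) = 0"
        by (simp only: sum_divide_distrib power_divide times_divide_eq_right)
    qed
    then show False using mS pos[OF assms(2) mS(1)] by simp
  qed
  \<comment> \<open>Only \<open>c p\<close> is left, and \<open>G p p = 1\<close> turns row
    \<open>p\<close> into \<open>c p = 0\<close>.\<close>
  have "(\<Sum>j\<in>S. G p j powr s * c j) = c p"
  proof -
    have "(\<Sum>j\<in>S. G p j powr s * c j) = (\<Sum>j\<in>S. if j = p then c p else 0)"
      using c0 diag[OF assms(2)] by (intro sum.cong refl) auto
    then show ?thesis using assms(1,2) by simp
  qed
  then have "c p = 0" using c assms(2) by simp
  then show "\<forall>j\<in>S. c j = 0" using c0 by blast
qed

section \<open>Openness of nondegeneracy\<close>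

text \<open>The tube lemma for filters: near each point of \<open>C\<close> one condition on
  \<open>x\<close> suffices; finitely many such neighbourhoods cover \<open>C\<close>, and their
  conditions are intersected.\<close>

lemma eventually_ball_compact:
  assumes "compact C"
    and "\<And>c. c \<in> C \<Longrightarrow> eventually (\<lambda>(c', x). P c' x) (nhds c \<times>\<^sub>F F)"
  shows "eventually (\<lambda>x. \<forall>c\<in>C. P c x) F"
proof -
  have "\<exists>U Q. open U \<and> c \<in> U \<and> eventually Q F \<and> (\<forall>c'\<in>U. \<forall>x. Q x \<longrightarrow> P c' x)" if c: "c \<in> C" for c
  proof -
    obtain R Q where "eventually R (nhds c)" and Q: "eventually Q F"
      and RQ: "\<And>c' x. R c' \<Longrightarrow> Q x \<Longrightarrow> P c' x"
      using assms(2)[OF c, unfolded eventually_prod_filter prod.case] by blast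
    then obtain U where "open U" "c \<in> U" "\<And>c'. c' \<in> U \<Longrightarrow> R c'"
      unfolding eventually_nhds by auto
    then show ?thesis using Q RQ by meson
  qed
  then obtain U Q where UQ: "\<And>c. c \<in> C \<Longrightarrow> open (U c) \<and> c \<in> U c \<and> eventually (Q c) F \<and>
      (\<forall>c'\<in>U c. \<forall>x. Q c x \<longrightarrow> P c' x)" by metis
  obtain D where D: "D \<subseteq> C" "finite D" "C \<subseteq> (\<Union>c\<in>D. U c)"
    using compactE_image[OF assms(1), of C U] UQ by blast
  have "eventually (\<lambda>x. \<forall>c\<in>D. Q c x) F"
    using D UQ by (intro eventually_ball_finite) auto
  then show ?thesis
    by eventually_elim (use D UQ in blast)
qed

text \<open>Tychonoff's theorem, carried over to the topology of the function type.\<close>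

lemma compact_Pi_UNIV:
  fixes B :: "'i \<Rightarrow> 'b::topological_space set"
  assumes "\<And>i. compact (B i)"
  shows "compact (Pi UNIV B)"
proof -
  have "compactin (product_topology (\<lambda>_. euclidean) UNIV) (Pi\<^sub>E UNIV B)"
    using assms by (simp add: compactin_PiE)
  then show ?thesis by (simp add: euclidean_product_topology PiE_def)
qed

lemma tendsto_coordinate:
  fixes K0 :: "'i \<Rightarrow> 'b::topological_space"
  shows "((\<lambda>K. K i) \<longlongrightarrow> K0 i) (nhds K0)"
proof (rule topological_tendstoI)
  fix T :: "'b set" assume T: "open T" "K0 i \<in> T"
  have "open ((\<lambda>K :: 'i \<Rightarrow> 'b. K i) -` T)"
    using continuous_on_product_coordinates[of i] T(1)
    using continuous_on_open_vimage[OF open_UNIV] by fastforce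
  then show "eventually (\<lambda>K. K i \<in> T) (nhds K0)"
    using T(2) unfolding eventually_nhds by blast
qed

text \<open>Degeneracy means that the squared length \<open>\<Phi>\<close> of the image vector has a
  zero on the unit sphere. As \<open>\<Phi>\<close> is continuous in vector and matrix jointly,
  compactness makes its nonvanishing persist.\<close>

lemma eventually_nondegenerate_on:
  fixes A :: "'b \<Rightarrow> 'i \<Rightarrow> 'i \<Rightarrow> real"
  assumes "finite S" "nondegenerate_on S A0"
    and lim: "\<And>i j. i \<in> S \<Longrightarrow> j \<in> S \<Longrightarrow> ((\<lambda>x. A x i j) \<longlongrightarrow> A0 i j) F"
  shows "eventually (\<lambda>x. nondegenerate_on S (A x)) F"
proof -
  \<comment> \<open>The unit sphere of the sup norm, as a union of faces, each compact by Tychonoff's theorem.\<close>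
  define B where "B m j = (if j = m then {1} else if j \<in> S then {-1..1} else {0::real})" for m j
  have comp: "compact (Pi UNIV (B m))" for m
    by (rule compact_Pi_UNIV) (simp add: B_def)
  define \<Phi> where "\<Phi> = (\<lambda>(c, x). \<Sum>i\<in>S. (\<Sum>j\<in>S. A x i j * c j)\<^sup>2)"
  have "eventually (\<lambda>x. \<forall>m\<in>S. \<forall>c\<in>Pi UNIV (B m). \<Phi> (c, x) \<noteq> 0) F"
  proof (rule eventually_ball_finite[OF assms(1)], rule ballI, rule eventually_ball_compact[OF comp])
    fix m c assume m: "m \<in> S" and c: "c \<in> Pi UNIV (B m)"
    have "(\<Phi> \<longlongrightarrow> (\<Sum>i\<in>S. (\<Sum>j\<in>S. A0 i j * c j)\<^sup>2)) (nhds c \<times>\<^sub>F F)"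
      unfolding \<Phi>_def case_prod_unfold
      by (intro tendsto_sum tendsto_power tendsto_mult
          filterlim_compose[OF lim filterlim_snd] filterlim_compose[OF tendsto_coordinate filterlim_fst])
    moreover have "(\<Sum>i\<in>S. (\<Sum>j\<in>S. A0 i j * c j)\<^sup>2) \<noteq> 0"
    proof
      assume "(\<Sum>i\<in>S. (\<Sum>j\<in>S. A0 i j * c j)\<^sup>2) = 0"
      then have "\<forall>i\<in>S. (\<Sum>j\<in>S. A0 i j * c j) = 0"
        using assms(1) by (simp add: sum_nonneg_eq_0_iff)
      then have "c m = 0" using assms(2) m by (simp add: nondegenerate_on_def)
      moreover have "c m \<in> B m m" using c by (meson Pi_iff UNIV_I)
      ultimately show False by (simp add: B_def)
    qed
    ultimately have "eventually (\<lambda>p. \<Phi> p \<noteq> 0) (nhds c \<times>\<^sub>F F)"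
      by (rule tendsto_imp_eventually_ne)
    then show "eventually (\<lambda>(c, x). \<Phi> (c, x) \<noteq> 0) (nhds c \<times>\<^sub>F F)"
      by (simp add: case_prod_unfold)
  qed
  then show ?thesis
  proof eventually_elim
    case (elim x)
    show ?case
      unfolding nondegenerate_on_def
    proof (intro allI impI ballI)
      fix c j assume c: "\<forall>i\<in>S. (\<Sum>j\<in>S. A x i j * c j) = 0" and j: "j \<in> S"
      show "c j = 0"
      proof (rule ccontr)
        assume cj: "c j \<noteq> 0"
        obtain m where m: "m \<in> S" "\<And>i. i \<in> S \<Longrightarrow> \<bar>c i\<bar> \<le> \<bar>c m\<bar>"
          using finite_obtains_argmax[OF assms(1), of "\<lambda>i. \<bar>c i\<bar>"] j by blast
        then have cm: "c m \<noteq> 0" using cj j by fastforce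
        \<comment> \<open>Division by the entry of largest modulus, sign included, leads to a face
          with value 1 at \<open>m\<close>, so the faces with value -1 are covered too.\<close>
        define c' where "c' i = (if i \<in> S then c i / c m else 0)" for i
        have "c' \<in> Pi UNIV (B m)"
        proof
          fix i
          show "c' i \<in> B m i"
          proof (cases "i \<in> S")
            case True
            then have "\<bar>c i / c m\<bar> \<le> 1" using m(2)[OF True] cm by (simp add: abs_divide divide_le_eq)
            then have "- 1 \<le> c i / c m" "c i / c m \<le> 1" by linarith+
            then show ?thesis using True cm by (simp add: B_def c'_def)
          qed (use m in \<open>auto simp: B_def c'_def\<close>)
        qed
        then have "\<Phi> (c', x) \<noteq> 0" using elim m by blast
        moreover have "(\<Sum>j\<in>S. A x i j * c' j) = (\<Sum>j\<in>S. A x i j * c j) / c m" for i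
          unfolding sum_divide_distrib by (intro sum.cong refl) (simp add: c'_def)
        ultimately show False using c by (simp add: \<Phi>_def)
      qed
    qed
  qed
qed

section \<open>Lorentz geometry in finite dimension\<close>

lemma lorentz_form_finite:
  "finite I \<Longrightarrow> lorentz_form I x y = fst x * fst y - (\<Sum>i\<in>I. snd x i * snd y i)"
  by (simp add: lorentz_form_def)

lemma lorentz_form_commute: "lorentz_form I x y = lorentz_form I y x"
  by (simp add: lorentz_form_def mult.commute)

definition lincomb :: "'j set \<Rightarrow> ('j \<Rightarrow> real) \<Rightarrow> ('j \<Rightarrow> real \<times> ('i \<Rightarrow> real)) \<Rightarrow> real \<times> ('i \<Rightarrow> real)" where
  "lincomb S c f = (\<Sum>j\<in>S. c j * fst (f j), \<lambda>i. \<Sum>j\<in>S. c j * snd (f j) i)"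

lemma lorentz_form_lincomb:
  assumes "finite I"
  shows "lorentz_form I (lincomb S c f) y = (\<Sum>j\<in>S. c j * lorentz_form I (f j) y)"
proof -
  have "(\<Sum>i\<in>I. (\<Sum>j\<in>S. c j * snd (f j) i) * snd y i) =
      (\<Sum>i\<in>I. \<Sum>j\<in>S. c j * (snd (f j) i * snd y i))"
    by (simp add: sum_distrib_right mult.assoc)
  also have "\<dots> = (\<Sum>j\<in>S. \<Sum>i\<in>I. c j * (snd (f j) i * snd y i))" by (rule sum.swap)
  finally show ?thesis using assms
    by (simp add: lorentz_form_finite lincomb_def sum_distrib_left sum_distrib_right
        sum_subtractf algebra_simps)
qed

lemma lorentz_form_lincomb2:
  assumes "finite I"
  shows "lorentz_form I (lincomb S c f) (lincomb S c f) =
    (\<Sum>i\<in>S. \<Sum>j\<in>S. c i * c j * lorentz_form I (f i) (f j))"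
proof -
  have "lorentz_form I (f i) (lincomb S c f) = (\<Sum>j\<in>S. c j * lorentz_form I (f i) (f j))" for i
    unfolding lorentz_form_commute[of I "f i"] by (rule lorentz_form_lincomb[OF assms])
  then show ?thesis
    by (simp add: lorentz_form_lincomb[OF assms] sum_distrib_left mult.assoc)
qed

definition comb2 :: "real \<Rightarrow> real \<times> ('i \<Rightarrow> real) \<Rightarrow> real \<Rightarrow> real \<times> ('i \<Rightarrow> real) \<Rightarrow> real \<times> ('i \<Rightarrow> real)" where
  "comb2 a x b y = (a * fst x + b * fst y, \<lambda>i. a * snd x i + b * snd y i)"

lemma lorentz_form_comb2:
  assumes "finite I"
  shows "lorentz_form I (comb2 a x b y) z = a * lorentz_form I x z + b * lorentz_form I y z"
    and "lorentz_form I z (comb2 a x b y) = a * lorentz_form I z x + b * lorentz_form I z y"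
  using assms
  by (simp_all add: lorentz_form_finite comb2_def algebra_simps sum.distrib sum_distrib_left)

lemma hyp_spaceD:
  assumes "p \<in> hyp_space I"
  shows "lorentz_form I p p = 1" "0 < fst p"
  using assms by (auto simp: hyp_space_def)

text \<open>The orthogonal complement of a timelike vector is negative definite: Cauchy-Schwarz for
  the space parts, whose square sum for \<open>p\<close> is \<open>(fst p)\<^sup>2 - 1\<close>,
  leaves a slack \<open>- U\<close> that also settles the case of equality.\<close>

lemma lorentz_form_orthogonal:
  assumes "finite I" "p \<in> hyp_space I" "lorentz_form I u p = 0"
  shows "lorentz_form I u u \<le> 0"
    and "lorentz_form I u u = 0 \<Longrightarrow> fst u = 0 \<and> (\<forall>i\<in>I. snd u i = 0)"
proof -
  define U where "U = (\<Sum>i\<in>I. (snd u i)\<^sup>2)"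
  have U0: "0 \<le> U" by (simp add: U_def sum_nonneg)
  have LU: "lorentz_form I u u = (fst u)\<^sup>2 - U"
    using assms(1) by (simp add: lorentz_form_finite U_def power2_eq_square)
  have "(\<Sum>i\<in>I. (snd p i)\<^sup>2) = (fst p)\<^sup>2 - 1"
    using hyp_spaceD(1)[OF assms(2)] assms(1) by (simp add: lorentz_form_finite power2_eq_square)
  moreover have "(fst u * fst p)\<^sup>2 = (\<Sum>i\<in>I. snd u i * snd p i)\<^sup>2"
    using assms(1,3) by (simp add: lorentz_form_finite)
  moreover have "(\<Sum>i\<in>I. snd u i * snd p i)\<^sup>2 \<le> U * (\<Sum>i\<in>I. (snd p i)\<^sup>2)"
    unfolding U_def by (rule Cauchy_Schwarz_ineq_sum)
  ultimately have "(fst u * fst p)\<^sup>2 \<le> U * ((fst p)\<^sup>2 - 1)" by simp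
  then have *: "((fst u)\<^sup>2 - U) * (fst p)\<^sup>2 \<le> - U" by (simp add: algebra_simps power_mult_distrib)
  have p: "0 < (fst p)\<^sup>2" using hyp_spaceD(2)[OF assms(2)] by simp
  show "lorentz_form I u u \<le> 0"
  proof (rule ccontr)
    assume "\<not> lorentz_form I u u \<le> 0"
    then have "0 < ((fst u)\<^sup>2 - U) * (fst p)\<^sup>2" using p LU by simp
    then show False using * U0 by linarith
  qed
  show "fst u = 0 \<and> (\<forall>i\<in>I. snd u i = 0)" if "lorentz_form I u u = 0"
  proof -
    have "U = 0" "fst u = 0" using that LU * U0 by auto
    then show ?thesis using assms(1) by (simp add: U_def sum_nonneg_eq_0_iff)
  qed
qed

text \<open>Removing from \<open>v\<close> its component along \<open>p\<close> leaves a vector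
  orthogonal to \<open>p\<close> whose form is the difference of the two sides.\<close>

lemma lorentz_form_reverse_CS:
  assumes "finite I" "p \<in> hyp_space I"
  shows "lorentz_form I v v \<le> (lorentz_form I v p)\<^sup>2"
    and "lorentz_form I v v = (lorentz_form I v p)\<^sup>2 \<Longrightarrow>
      fst v = lorentz_form I v p * fst p \<and> (\<forall>i\<in>I. snd v i = lorentz_form I v p * snd p i)"
proof -
  let ?u = "comb2 1 v (- lorentz_form I v p) p"
  note pp = hyp_spaceD(1)[OF assms(2)]
  have ort: "lorentz_form I ?u p = 0"
    using assms(1) pp by (simp add: lorentz_form_comb2)
  have q: "lorentz_form I ?u ?u = lorentz_form I v v - (lorentz_form I v p)\<^sup>2"
    using assms(1) pp lorentz_form_commute[of I p v]
    by (simp add: lorentz_form_comb2 power2_eq_square)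
  show "lorentz_form I v v \<le> (lorentz_form I v p)\<^sup>2"
    using lorentz_form_orthogonal(1)[OF assms ort] q by simp
  assume "lorentz_form I v v = (lorentz_form I v p)\<^sup>2"
  then have "lorentz_form I ?u ?u = 0" unfolding q by (rule eq_iff_diff_eq_0[THEN iffD1])
  then show "fst v = lorentz_form I v p * fst p \<and> (\<forall>i\<in>I. snd v i = lorentz_form I v p * snd p i)"
    using lorentz_form_orthogonal(2)[OF assms ort \<open>lorentz_form I ?u ?u = 0\<close>]
    by (simp add: comb2_def)
qed

text \<open>Cauchy-Schwarz for the space parts and the positive time coordinates give the sign,
  reverse Cauchy-Schwarz the modulus.\<close>

lemma lorentz_form_ge_1:
  assumes "finite I" "p \<in> hyp_space I" "q \<in> hyp_space I"
  shows "1 \<le> lorentz_form I p q"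
proof -
  have sq: "(\<Sum>i\<in>I. (snd x i)\<^sup>2) = (fst x)\<^sup>2 - 1" if "x \<in> hyp_space I" for x
    using hyp_spaceD(1)[OF that] assms(1) by (simp add: lorentz_form_finite power2_eq_square)
  have ge: "0 \<le> (fst x)\<^sup>2 - 1" if "x \<in> hyp_space I" for x
    using sq[OF that] by (metis sum_nonneg zero_le_power2)
  have "(\<Sum>i\<in>I. snd p i * snd q i)\<^sup>2 \<le> ((fst p)\<^sup>2 - 1) * ((fst q)\<^sup>2 - 1)"
    using Cauchy_Schwarz_ineq_sum[of "snd p" "snd q" I] sq assms by simp
  also have "\<dots> \<le> (fst p)\<^sup>2 * (fst q)\<^sup>2"
    using ge assms by (intro mult_mono) auto
  finally have "\<bar>\<Sum>i\<in>I. snd p i * snd q i\<bar> \<le> \<bar>fst p * fst q\<bar>"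
    by (simp add: abs_le_square_iff power_mult_distrib)
  then have "0 \<le> lorentz_form I p q"
    using assms hyp_spaceD(2)[of p I] hyp_spaceD(2)[of q I] by (simp add: lorentz_form_finite)
  moreover have "1\<^sup>2 \<le> (lorentz_form I p q)\<^sup>2"
    using lorentz_form_reverse_CS(1)[OF assms(1,3), of p] hyp_spaceD(1)[OF assms(2)] by simp
  ultimately show ?thesis by (metis power2_le_imp_le)
qed

lemma cosh_hyp_dist:
  assumes "finite I" "p \<in> hyp_space I" "q \<in> hyp_space I"
  shows "cosh (hyp_dist I p q) = lorentz_form I p q"
  using lorentz_form_ge_1[OF assms] by (simp add: hyp_dist_def)

lemma lorentz_form_eq_1:
  assumes "finite I" "p \<in> hyp_space I" "q \<in> hyp_space I" "lorentz_form I p q = 1"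
  shows "fst p = fst q \<and> (\<forall>i\<in>I. snd p i = snd q i)"
proof -
  have "lorentz_form I p p = (lorentz_form I p q)\<^sup>2"
    by (simp add: assms(4) hyp_spaceD(1)[OF assms(2)])
  from lorentz_form_reverse_CS(2)[OF assms(1,3) this] show ?thesis by (simp add: assms(4))
qed

text \<open>On the complement of \<open>p\<close> the negated form is an inner product;
  \<open>?w\<close> is the usual Cauchy-Schwarz witness, written without division.\<close>

lemma lorentz_form_CS_orthogonal:
  assumes "finite I" "p \<in> hyp_space I" "lorentz_form I u p = 0" "lorentz_form I z p = 0"
  shows "(lorentz_form I u z)\<^sup>2 \<le> lorentz_form I u u * lorentz_form I z z"
proof (cases "lorentz_form I z z = 0")
  case True
  have "lorentz_form I u z = 0"
    using lorentz_form_orthogonal(2)[OF assms(1,2,4) True] assms(1) by (simp add: lorentz_form_finite)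
  then show ?thesis using True by simp
next
  case False
  then have neg: "lorentz_form I z z < 0"
    using lorentz_form_orthogonal(1)[OF assms(1,2,4)] by simp
  let ?w = "comb2 (lorentz_form I z z) u (- lorentz_form I u z) z"
  have "lorentz_form I ?w p = 0" using assms by (simp add: lorentz_form_comb2)
  then have "lorentz_form I ?w ?w \<le> 0" by (rule lorentz_form_orthogonal(1)[OF assms(1,2)])
  moreover have "lorentz_form I ?w ?w =
      lorentz_form I z z * (lorentz_form I u u * lorentz_form I z z - (lorentz_form I u z)\<^sup>2)"
    using assms(1) lorentz_form_commute[of I z u]
    by (simp add: lorentz_form_comb2 power2_eq_square algebra_simps)
  ultimately show ?thesis using neg by (simp add: mult_le_0_iff)
qed

section \<open>Hyperplanes are closed, totally geodesic and proper\<close>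

lemma hyp_closed_hyperplane:
  assumes "finite I"
  shows "hyp_closed I {p \<in> hyp_space I. lorentz_form I p v = 0}"
  unfolding hyp_closed_def
proof (intro conjI ballI impI)
  fix p assume p: "p \<in> hyp_space I"
    and near: "\<forall>e>0. \<exists>q\<in>{p \<in> hyp_space I. lorentz_form I p v = 0}. hyp_dist I p q < e"
  define \<beta> where "\<beta> = lorentz_form I v p"
  define M where "M = \<beta>\<^sup>2 - lorentz_form I v v"
  note pp = hyp_spaceD(1)[OF p]
  have M: "0 \<le> M" unfolding M_def \<beta>_def using lorentz_form_reverse_CS(1)[OF assms p, of v] by simp
  \<comment> \<open>A point with \<open>\<beta> \<noteq> 0\<close> has positive distance from the hyperplane.\<close>
  have bound: "\<beta>\<^sup>2 \<le> ((cosh e)\<^sup>2 - 1) * M" if e: "0 < e" for e :: real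
  proof -
    obtain q where q: "q \<in> hyp_space I" "lorentz_form I q v = 0" "hyp_dist I p q < e"
      using near e by blast
    let ?C = "lorentz_form I q p"
    have C1: "1 \<le> ?C" by (rule lorentz_form_ge_1[OF assms q(1) p])
    have "0 \<le> hyp_dist I p q"
      using C1 lorentz_form_commute[of I p q] by (simp add: hyp_dist_def)
    then have "cosh (hyp_dist I p q) \<le> cosh e" using q(3) e by (simp add: cosh_real_nonneg_le_iff)
    then have Ce: "?C \<le> cosh e"
      using cosh_hyp_dist[OF assms p q(1)] lorentz_form_commute[of I p q] by simp
    \<comment> \<open>These are the parts of \<open>q\<close> and \<open>v\<close> orthogonal to
      \<open>p\<close>, with forms \<open>1 - ?C\<^sup>2\<close> and \<open>- M\<close>.
      Cauchy-Schwarz for them bounds \<open>\<beta>\<close> by a quantity that tends to 0 with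
      \<open>e\<close>.\<close>
    let ?u = "comb2 1 q (- ?C) p" and ?z = "comb2 1 v (- \<beta>) p"
    have "lorentz_form I ?u p = 0" "lorentz_form I ?z p = 0"
      using assms pp by (simp_all add: lorentz_form_comb2 \<beta>_def)
    then have "(lorentz_form I ?u ?z)\<^sup>2 \<le> lorentz_form I ?u ?u * lorentz_form I ?z ?z"
      by (rule lorentz_form_CS_orthogonal[OF assms p])
    moreover have "lorentz_form I ?u ?z = - \<beta> * ?C"
      using assms pp q(2) lorentz_form_commute[of I p v]
      by (simp add: lorentz_form_comb2 \<beta>_def algebra_simps)
    moreover have "lorentz_form I ?u ?u = 1 - ?C\<^sup>2"
      using assms pp hyp_spaceD(1)[OF q(1)] lorentz_form_commute[of I p q]
      by (simp add: lorentz_form_comb2 power2_eq_square algebra_simps)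
    moreover have "lorentz_form I ?z ?z = - M"
      using assms pp lorentz_form_commute[of I p v]
      by (simp add: lorentz_form_comb2 power2_eq_square algebra_simps \<beta>_def M_def)
    ultimately have "\<beta>\<^sup>2 * ?C\<^sup>2 \<le> (?C\<^sup>2 - 1) * M"
      by (simp add: power_mult_distrib algebra_simps)
    moreover have "1 \<le> ?C\<^sup>2" using C1 by simp
    then have "\<beta>\<^sup>2 * 1 \<le> \<beta>\<^sup>2 * ?C\<^sup>2" by (intro mult_left_mono) auto
    moreover have "?C\<^sup>2 \<le> (cosh e)\<^sup>2" using Ce C1 by (intro power_mono) auto
    then have "(?C\<^sup>2 - 1) * M \<le> ((cosh e)\<^sup>2 - 1) * M" using M by (intro mult_right_mono) auto
    ultimately show ?thesis by linarith
  qed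
  have "((\<lambda>e::real. ((cosh e)\<^sup>2 - 1) * M) \<longlongrightarrow> ((cosh 0)\<^sup>2 - 1) * M) (at_right 0)"
    by (intro tendsto_intros)
  then have lim: "((\<lambda>e::real. ((cosh e)\<^sup>2 - 1) * M) \<longlongrightarrow> 0) (at_right 0)" by simp
  have "\<beta>\<^sup>2 \<le> 0"
    by (rule tendsto_lowerbound[OF lim])
      (auto simp: eventually_at_right_less intro: eventually_mono[OF eventually_at_right_less[of "0::real"] bound])
  then show "p \<in> {p \<in> hyp_space I. lorentz_form I p v = 0}"
    using p lorentz_form_commute[of I p v] by (simp add: \<beta>_def)
qed auto

lemma totally_geodesic_hyperplane:
  assumes "finite I"
  shows "totally_geodesic I {p \<in> hyp_space I. lorentz_form I p v = 0}"
  unfolding totally_geodesic_def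
proof (intro conjI allI impI subsetI)
  fix g s t x
  assume "geodesic_line I g \<and> s \<noteq> t \<and> g s \<in> {p \<in> hyp_space I. lorentz_form I p v = 0} \<and>
    g t \<in> {p \<in> hyp_space I. lorentz_form I p v = 0}" and "x \<in> range g"
  then obtain u where x: "x = g u" and st: "s \<noteq> t"
    and v: "lorentz_form I (g s) v = 0" "lorentz_form I (g t) v = 0"
    and gH: "\<And>u. g u \<in> hyp_space I" and gd: "\<And>a b. hyp_dist I (g a) (g b) = \<bar>a - b\<bar>"
    by (auto simp: geodesic_line_def)
  have L: "lorentz_form I (g a) (g b) = cosh (a - b)" for a b
    using cosh_hyp_dist[OF assms gH gH, of a b] gd[of a b] by simp
  have sh: "sinh (s - t) \<noteq> 0" using st by simp
  \<comment> \<open>The coefficients for which \<open>g u\<close> is \<open>a\<close> times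
    \<open>g s\<close> plus \<open>b\<close> times \<open>g t\<close>: a geodesic lies in the plane
    spanned by any two of its points.\<close>
  define a where "a = sinh (u - t) / sinh (s - t)"
  define b where "b = sinh (s - u) / sinh (s - t)"
  have E: "a * cosh (s - r) + b * cosh (t - r) = cosh (u - r)" for r
  proof -
    have "sinh (u - t) * cosh (s - r) + sinh (s - u) * cosh (t - r) = sinh (s - t) * cosh (u - r)"
      unfolding sinh_field_def cosh_field_def
      by (simp add: field_simps flip: exp_add)
    then show ?thesis using sh by (simp add: a_def b_def field_simps)
  qed
  \<comment> \<open>This difference is orthogonal to every \<open>g r\<close>, hence to itself, and
    vanishes by definiteness of the complement of a point.\<close>
  let ?w = "comb2 1 (g u) (- 1) (comb2 a (g s) b (g t))"
  have w: "lorentz_form I ?w (g r) = 0" for r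
    using assms E[of r] by (simp add: lorentz_form_comb2 L)
  have "lorentz_form I ?w ?w = 0"
    using assms w by (subst lorentz_form_comb2(2)) (simp_all add: lorentz_form_comb2(2))
  then have z: "fst ?w = 0 \<and> (\<forall>i\<in>I. snd ?w i = 0)"
    by (rule lorentz_form_orthogonal(2)[OF assms gH w])
  then have "lorentz_form I ?w v = 0" using assms by (simp add: lorentz_form_finite)
  then have "lorentz_form I (g u) v = 0" using v assms by (simp add: lorentz_form_comb2)
  then show "x \<in> {p \<in> hyp_space I. lorentz_form I p v = 0}" using gH x by simp
qed auto

lemma hyp_space_not_in_hyperplane:
  assumes "finite I" "fst v \<noteq> 0 \<or> (\<exists>i\<in>I. snd v i \<noteq> 0)"
  shows "{p \<in> hyp_space I. lorentz_form I p v = 0} \<noteq> hyp_space I"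
proof (cases "fst v = 0")
  case False
  let ?p = "(1, \<lambda>_. 0) :: real \<times> ('a \<Rightarrow> real)"
  have "?p \<in> hyp_space I" by (simp add: hyp_space_def ell2_def lorentz_form_def)
  moreover have "lorentz_form I ?p v \<noteq> 0" using False by (simp add: lorentz_form_def)
  ultimately show ?thesis by blast
next
  case True
  then obtain k where k: "k \<in> I" "snd v k \<noteq> 0" using assms(2) by blast
  \<comment> \<open>The time coordinate \<open>sqrt 2\<close> lifts the unit vector at
    \<open>k\<close> to the hyperboloid, as \<open>2 - 1 = 1\<close>.\<close>
  let ?p = "(sqrt 2, \<lambda>i. if i = k then 1 else 0) :: real \<times> ('a \<Rightarrow> real)"
  have *: "(\<Sum>i\<in>I. (if i = k then 1 else 0) * c i) = c k" for c :: "'a \<Rightarrow> real"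
    using assms(1) k by (simp add: if_distrib if_distribR cong: if_cong)
  have "?p \<in> hyp_space I"
    using assms(1) k *[of "\<lambda>i. if i = k then 1 else 0"]
    by (auto simp: hyp_space_def ell2_def lorentz_form_finite)
  moreover have "lorentz_form I ?p v \<noteq> 0"
    using k True assms(1) *[of "snd v"] by (simp add: lorentz_form_finite)
  ultimately show ?thesis by blast
qed

text \<open>Totality rules out hyperplanes as containers of the image. This is the only form in
  which totality is used.\<close>

lemma hyp_total_hyperplane:
  assumes "finite I" "hyp_total I A" "A \<subseteq> hyp_space I"
    and "fst v \<noteq> 0 \<or> (\<exists>i\<in>I. snd v i \<noteq> 0)"
  obtains p where "p \<in> A" "lorentz_form I p v \<noteq> 0"
proof -
  have "\<not> A \<subseteq> {p \<in> hyp_space I. lorentz_form I p v = 0}"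
    using assms(2) hyp_closed_hyperplane[OF assms(1)] totally_geodesic_hyperplane[OF assms(1)]
      hyp_space_not_in_hyperplane[OF assms(1,4)] unfolding hyp_total_def by blast
  then show thesis using that assms(3) by blast
qed

section \<open>Gram matrices and the dimension of a representation\<close>

text \<open>Gaussian elimination: a nonzero equation \<open>k\<close> with pivot \<open>p\<close> is
  used up to eliminate the unknown \<open>p\<close> from the others.\<close>

lemma underdetermined_system:
  fixes A :: "'e \<Rightarrow> 't \<Rightarrow> real"
  assumes "finite E" "finite T" "card E < card T"
  shows "\<exists>v. (\<exists>t\<in>T. v t \<noteq> 0) \<and> (\<forall>e\<in>E. (\<Sum>t\<in>T. A e t * v t) = 0)"
  using assms
proof (induction E arbitrary: T A rule: finite_induct)
  case empty
  then show ?case by (intro exI[of _ "\<lambda>_. 1"]) (auto simp: card_gt_0_iff)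
next
  case (insert k E)
  show ?case
  proof (cases "\<forall>t\<in>T. A k t = 0")
    case True
    moreover obtain v where "\<exists>t\<in>T. v t \<noteq> 0" "\<forall>e\<in>E. (\<Sum>t\<in>T. A e t * v t) = 0"
      using insert.IH[of T A] insert.prems insert.hyps by auto
    ultimately show ?thesis by (intro exI[of _ v]) auto
  next
    case False
    then obtain p where p: "p \<in> T" "A k p \<noteq> 0" by blast
    define T' where "T' = T - {p}"
    have T: "T = insert p T'" "p \<notin> T'" "finite T'" using p insert.prems by (auto simp: T'_def)
    have "card E < card T'" using insert.prems insert.hyps T by simp
    then obtain v where v: "\<exists>t\<in>T'. v t \<noteq> 0"
      "\<forall>e\<in>E. (\<Sum>t\<in>T'. (A e t - A e p * A k t / A k p) * v t) = 0"
      using insert.IH[OF T(3), of "\<lambda>e t. A e t - A e p * A k t / A k p"] by auto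
    \<comment> \<open>Back substitution: the value at \<open>p\<close> that solves equation
      \<open>k\<close>.\<close>
    define c where "c = - (\<Sum>t\<in>T'. A k t * v t) / A k p"
    have sum: "(\<Sum>t\<in>T. A e t * (v(p := c)) t) = A e p * c + (\<Sum>t\<in>T'. A e t * v t)" for e
    proof -
      have "(\<Sum>t\<in>T'. A e t * (v(p := c)) t) = (\<Sum>t\<in>T'. A e t * v t)"
        using T by (intro sum.cong refl) auto
      then show ?thesis using T by simp
    qed
    have "(\<Sum>t\<in>T. A k t * (v(p := c)) t) = 0" unfolding sum using p by (simp add: c_def)
    moreover have "(\<Sum>t\<in>T. A e t * (v(p := c)) t) = 0" if "e \<in> E" for e
    proof -
      have "(\<Sum>t\<in>T'. (A e t - A e p * A k t / A k p) * v t) =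
          (\<Sum>t\<in>T'. A e t * v t) - (A e p / A k p) * (\<Sum>t\<in>T'. A k t * v t)"
        by (simp add: left_diff_distrib sum_subtractf sum_distrib_left mult.assoc)
      then show ?thesis unfolding sum using v(2) that by (simp add: c_def)
    qed
    moreover have "\<exists>t\<in>T. (v(p := c)) t \<noteq> 0" using v(1) T by auto
    ultimately show ?thesis by blast
  qed
qed

text \<open>More than \<open>1 + card I\<close> vectors in dimension \<open>1 + card I\<close> are
  linearly dependent, and the coefficients of a dependence form a null vector of the Gram
  matrix.\<close>

lemma gram_degenerate:
  fixes f :: "'j \<Rightarrow> real \<times> ('i \<Rightarrow> real)"
  assumes "finite I" "finite S" "Suc (card I) < card S"
  shows "\<not> nondegenerate_on S (\<lambda>i j. lorentz_form I (f i) (f j))"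
proof -
  \<comment> \<open>\<open>None\<close> indexes the time coordinate, \<open>Some i\<close> the space
    coordinates.\<close>
  define A where "A e t = (case e of None \<Rightarrow> fst (f t) | Some i \<Rightarrow> snd (f t) i)" for e t
  have "card (insert None (Some ` I)) < card S"
    using assms by (simp add: card_image)
  then obtain v where v: "\<exists>t\<in>S. v t \<noteq> 0"
    "\<forall>e\<in>insert None (Some ` I). (\<Sum>t\<in>S. A e t * v t) = 0"
    using underdetermined_system[of "insert None (Some ` I)" S A] assms by auto
  then have z: "fst (lincomb S v f) = 0" "\<And>i. i \<in> I \<Longrightarrow> snd (lincomb S v f) i = 0"
    by (auto simp: A_def lincomb_def mult.commute)
  have "(\<Sum>j\<in>S. lorentz_form I (f i) (f j) * v j) = 0" for i
  proof -
    have "(\<Sum>j\<in>S. lorentz_form I (f i) (f j) * v j) = lorentz_form I (lincomb S v f) (f i)"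
      by (simp add: lorentz_form_lincomb[OF assms(1)] lorentz_form_commute[of I "f i"] mult.commute)
    also have "\<dots> = 0" using z assms(1) by (simp add: lorentz_form_finite)
    finally show ?thesis .
  qed
  then show ?thesis using v(1) unfolding nondegenerate_on_def by blast
qed

text \<open>Greedy choice: at most \<open>card I\<close> vectors admit a nonzero vector
  \<open>v\<close> orthogonal to all of them, and totality supplies a point not orthogonal to
  \<open>v\<close>, hence independent of them.\<close>

lemma hyp_total_independent:
  fixes f :: "'a \<Rightarrow> real \<times> ('i \<Rightarrow> real)"
  assumes "finite I" "hyp_total I (range f)" "range f \<subseteq> hyp_space I" "k \<le> Suc (card I)"
  shows "\<exists>y :: nat \<Rightarrow> 'a. \<forall>c. fst (lincomb {..<k} c (\<lambda>j. f (y j))) = 0 \<and>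
    (\<forall>i\<in>I. snd (lincomb {..<k} c (\<lambda>j. f (y j))) i = 0) \<longrightarrow> (\<forall>j<k. c j = 0)"
  using assms(4)
proof (induction k)
  case 0
  then show ?case by simp
next
  case (Suc k)
  then obtain y :: "nat \<Rightarrow> 'a" where y: "\<And>c. fst (lincomb {..<k} c (\<lambda>j. f (y j))) = 0 \<Longrightarrow>
    (\<forall>i\<in>I. snd (lincomb {..<k} c (\<lambda>j. f (y j))) i = 0) \<Longrightarrow> (\<forall>j<k. c j = 0)" by auto
  \<comment> \<open>The minus sign makes the linear system express Lorentz orthogonality to
    \<open>v\<close>.\<close>
  define A where "A j e = (case e of None \<Rightarrow> fst (f (y j)) | Some i \<Rightarrow> - snd (f (y j)) i)" for j e
  have "card {..<k} < card (insert None (Some ` I))"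
    using Suc.prems assms(1) by (simp add: card_image)
  then obtain w where w: "\<exists>e\<in>insert None (Some ` I). w e \<noteq> 0"
    "\<forall>j<k. (\<Sum>e\<in>insert None (Some ` I). A j e * w e) = 0"
    using underdetermined_system[of "{..<k}" "insert None (Some ` I)" A] assms(1) by auto
  define v where "v = (w None, \<lambda>i. w (Some i))"
  have vo: "lorentz_form I (f (y j)) v = 0" if "j < k" for j
  proof -
    have "(\<Sum>e\<in>insert None (Some ` I). A j e * w e) = A j None * w None + (\<Sum>i\<in>I. A j (Some i) * w (Some i))"
      using assms(1) by (simp add: sum.reindex)
    then have "A j None * w None + (\<Sum>i\<in>I. A j (Some i) * w (Some i)) = 0"
      using w(2) that by metis
    then show ?thesis using assms(1)
      by (simp add: A_def v_def lorentz_form_finite sum_negf)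
  qed
  have "fst v \<noteq> 0 \<or> (\<exists>i\<in>I. snd v i \<noteq> 0)" using w(1) by (auto simp: v_def)
  then obtain p where "p \<in> range f" "lorentz_form I p v \<noteq> 0"
    by (rule hyp_total_hyperplane[OF assms(1-3)])
  then obtain x where x: "lorentz_form I (f x) v \<noteq> 0" by blast
  define y' where "y' = y(k := x)"
  have "\<forall>j<Suc k. c j = 0" if c: "fst (lincomb {..<Suc k} c (\<lambda>j. f (y' j))) = 0"
    "\<forall>i\<in>I. snd (lincomb {..<Suc k} c (\<lambda>j. f (y' j))) i = 0" for c
  proof -
    have "lorentz_form I (lincomb {..<Suc k} c (\<lambda>j. f (y' j))) v = 0"
      using c assms(1) by (simp add: lorentz_form_finite)
    then have "c k * lorentz_form I (f x) v = 0"
      using vo by (simp add: lorentz_form_lincomb[OF assms(1)] y'_def)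
    then have ck: "c k = 0" using x by simp
    have "fst (lincomb {..<k} c (\<lambda>j. f (y j))) = 0"
      using c(1) ck by (simp add: lincomb_def y'_def)
    moreover have "\<forall>i\<in>I. snd (lincomb {..<k} c (\<lambda>j. f (y j))) i = 0"
      using c(2) ck by (simp add: lincomb_def y'_def)
    ultimately have "\<forall>j<k. c j = 0" by (rule y)
    then show ?thesis using ck by (simp add: less_Suc_eq)
  qed
  then show ?case by blast
qed

text \<open>For a null vector \<open>c\<close> of the Gram matrix of independent points, the
  combination with coefficients \<open>c\<close> is orthogonal to all of them and so to itself. It
  vanishes in the definite complement of \<open>f (y 0)\<close>, and independence gives
  \<open>c = 0\<close>.\<close>

lemma hyp_total_nondegenerate:
  fixes f :: "'a \<Rightarrow> real \<times> ('i \<Rightarrow> real)"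
  assumes "finite I" "hyp_total I (range f)" "range f \<subseteq> hyp_space I"
  obtains y :: "nat \<Rightarrow> 'a" where
    "nondegenerate_on {..card I} (\<lambda>i j. lorentz_form I (f (y i)) (f (y j)))"
proof -
  let ?S = "{..card I}"
  obtain y :: "nat \<Rightarrow> 'a" where y: "\<And>c. fst (lincomb ?S c (\<lambda>j. f (y j))) = 0 \<Longrightarrow>
    \<forall>i\<in>I. snd (lincomb ?S c (\<lambda>j. f (y j))) i = 0 \<Longrightarrow> \<forall>j<Suc (card I). c j = 0"
    using hyp_total_independent[OF assms order_refl] by (auto simp: lessThan_Suc_atMost)
  have "nondegenerate_on ?S (\<lambda>i j. lorentz_form I (f (y i)) (f (y j)))"
    unfolding nondegenerate_on_def
  proof (intro allI impI)
    fix c assume c: "\<forall>i\<in>?S. (\<Sum>j\<in>?S. lorentz_form I (f (y i)) (f (y j)) * c j) = 0"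
    let ?w = "lincomb ?S c (\<lambda>j. f (y j))"
    have ort: "lorentz_form I ?w (f (y i)) = 0" if "i \<in> ?S" for i
    proof -
      have "lorentz_form I ?w (f (y i)) = (\<Sum>j\<in>?S. lorentz_form I (f (y i)) (f (y j)) * c j)"
        by (simp add: lorentz_form_lincomb[OF assms(1)] lorentz_form_commute[of I "f (y i)"] mult.commute)
      then show ?thesis using c that by simp
    qed
    have "lorentz_form I ?w ?w = (\<Sum>j\<in>?S. c j * lorentz_form I (f (y j)) ?w)"
      by (rule lorentz_form_lincomb[OF assms(1)])
    also have "\<dots> = 0"
      using ort by (intro sum.neutral ballI) (simp add: lorentz_form_commute[of I _ ?w] del: atMost_iff)
    finally have "lorentz_form I ?w ?w = 0" .
    moreover have "f (y 0) \<in> hyp_space I" using assms(3) by blast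
    ultimately have "fst ?w = 0 \<and> (\<forall>i\<in>I. snd ?w i = 0)"
      using lorentz_form_orthogonal(2)[OF assms(1) _ ort[of 0]] by blast
    then show "\<forall>j\<in>?S. c j = 0" using y[of c] by auto
  qed
  then show thesis by (rule that)
qed

text \<open>Reverse Cauchy-Schwarz for the combination of the \<open>f i\<close> with coefficients
  \<open>c\<close>, expanded.\<close>

lemma hyp_space_psd:
  assumes "finite I" "p \<in> hyp_space I"
  shows "psd_on S (\<lambda>i j. lorentz_form I p (f i) * lorentz_form I p (f j) - lorentz_form I (f i) (f j))"
  unfolding psd_on_def
proof (intro conjI ballI allI)
  fix c
  have "(\<Sum>i\<in>S. \<Sum>j\<in>S. c i * c j *
      (lorentz_form I p (f i) * lorentz_form I p (f j) - lorentz_form I (f i) (f j))) =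
      (lorentz_form I (lincomb S c f) p)\<^sup>2 - lorentz_form I (lincomb S c f) (lincomb S c f)"
    by (simp only: lorentz_form_lincomb2[OF assms(1)])
      (simp add: lorentz_form_lincomb[OF assms(1)] power2_eq_square sum_product right_diff_distrib sum_subtractf
        lorentz_form_commute[of I p] mult_ac)
  also have "\<dots> \<ge> 0" using lorentz_form_reverse_CS(1)[OF assms, of "lincomb S c f"] by simp
  finally show "0 \<le> (\<Sum>i\<in>S. \<Sum>j\<in>S. c i * c j *
      (lorentz_form I p (f i) * lorentz_form I p (f j) - lorentz_form I (f i) (f j)))" .
qed (simp add: lorentz_form_commute mult.commute)

lemma represents_kernel_finite:
  assumes "represents_kernel I f K" "finite I"
  shows "range f \<subseteq> hyp_space I" "K x y = lorentz_form I (f x) (f y)"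
proof -
  show r: "range f \<subseteq> hyp_space I"
    using assms(1) by (simp add: represents_kernel_def hyp_continuous_def)
  have "f x \<in> hyp_space I" "f y \<in> hyp_space I" using r by auto
  from cosh_hyp_dist[OF assms(2) this] show "K x y = lorentz_form I (f x) (f y)"
    using assms(1) by (simp add: represents_kernel_def)
qed

text \<open>\<open>{..n}\<close> has \<open>n + 1\<close> elements, and a finite representation
  places their points in dimension \<open>1 + card I\<close>; the time coordinate accounts for both
  shifts by 1.\<close>

lemma kernel_dim_ge:
  fixes K :: "'a::topological_space \<Rightarrow> 'a \<Rightarrow> real" and y :: "nat \<Rightarrow> 'a"
  assumes "nondegenerate_on {..n} (\<lambda>i j. K (y i) (y j))"
  shows "enat n \<le> kernel_dim K"
  unfolding kernel_dim_def
proof (rule Inf_greatest, clarify)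
  fix I :: "('a + nat) set" and f assume f: "represents_kernel I f K"
  show "enat n \<le> ecard I"
  proof (cases "finite I")
    case True
    have "\<not> Suc (card I) < card {..n}"
    proof
      assume "Suc (card I) < card {..n}"
      from gram_degenerate[OF True _ this, of "\<lambda>i. f (y i)"] show False
        using assms represents_kernel_finite(2)[OF f True] by simp
    qed
    then show ?thesis using True by (simp add: ecard_def)
  qed (simp add: ecard_def)
qed

section \<open>Kernels of hyperbolic type\<close>

lemma kernel_inequality_iff_psd:
  fixes K :: "'a \<Rightarrow> 'a \<Rightarrow> real" and x :: "nat \<Rightarrow> 'a"
  assumes "\<And>x y. K x y = K y x"
  shows "(\<forall>c. (\<Sum>i\<in>S. \<Sum>j\<in>S. c i * c j * K (x i) (x j)) \<le> (\<Sum>k\<in>S. c k * K z (x k))\<^sup>2) \<longleftrightarrow>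
    psd_on S (\<lambda>i j. K z (x i) * K z (x j) - K (x i) (x j))"
proof -
  have "(\<Sum>i\<in>S. \<Sum>j\<in>S. c i * c j * (K z (x i) * K z (x j) - K (x i) (x j))) =
      (\<Sum>k\<in>S. c k * K z (x k))\<^sup>2 - (\<Sum>i\<in>S. \<Sum>j\<in>S. c i * c j * K (x i) (x j))" for c
    by (simp add: power2_eq_square sum_product right_diff_distrib sum_subtractf mult_ac)
  then show ?thesis using assms by (simp add: psd_on_def mult.commute)
qed

lemma hyperbolic_kernel_iff:
  fixes K :: "'a::topological_space \<Rightarrow> 'a \<Rightarrow> real"
  shows "hyperbolic_kernel K \<longleftrightarrow>
     continuous_on UNIV (\<lambda>(x, y). K x y) \<and>
     (\<forall>x y. K x y = K y x) \<and>
     (\<forall>x y. 0 \<le> K x y) \<and>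
     (\<forall>x. K x x = 1) \<and>
     (\<forall>(n::nat) (x::nat \<Rightarrow> 'a). psd_on {1..n} (\<lambda>i j. K (x 0) (x i) * K (x 0) (x j) - K (x i) (x j)))"
  unfolding hyperbolic_kernel_def
  using kernel_inequality_iff_psd[of K] by meson

lemma hyperbolic_kernel_psd:
  assumes "hyperbolic_kernel K"
  shows "psd_on {1..n::nat} (\<lambda>i j. K (x 0) (x i) * K (x 0) (x j) - K (x i) (x j))"
proof -
  have "\<forall>(n::nat) x. psd_on {1..n} (\<lambda>i j. K (x 0) (x i) * K (x 0) (x j) - K (x i) (x j))"
    using assms unfolding hyperbolic_kernel_iff by (elim conjE) assumption
  then show ?thesis by (elim allE)
qed

text \<open>For the single point \<open>y\<close> and base point \<open>x\<close> the inequality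
  reads \<open>K y y \<le> (K x y)\<^sup>2\<close>.\<close>

lemma hyperbolic_kernel_ge_1:
  assumes "hyperbolic_kernel K"
  shows "1 \<le> K x y"
proof -
  let ?x = "\<lambda>i::nat. if i = 0 then x else y"
  have "psd_on {1..1} (\<lambda>i j. K (?x 0) (?x i) * K (?x 0) (?x j) - K (?x i) (?x j))"
    by (rule hyperbolic_kernel_psd[OF assms])
  from psd_on_diag[OF this, of 1] have "0 \<le> K x y * K x y - K y y" by simp
  then have "1\<^sup>2 \<le> (K x y)\<^sup>2"
    using assms by (simp add: hyperbolic_kernel_def power2_eq_square)
  then show ?thesis
    by (rule power2_le_imp_le) (use assms in \<open>simp add: hyperbolic_kernel_def\<close>)
qed

lemma continuous_kernel_powr:
  assumes "hyperbolic_kernel K"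
  shows "continuous_on UNIV (\<lambda>(x, y). kernel_powr K s x y)"
proof -
  have nz: "K x y \<noteq> 0" for x y
    using hyperbolic_kernel_ge_1[OF assms, of x y] by linarith
  have "continuous_on UNIV (\<lambda>(x, y). K x y)"
    using assms by (simp only: hyperbolic_kernel_def)
  then have "continuous_on UNIV (\<lambda>p. (case p of (x, y) \<Rightarrow> K x y) powr s)"
    by (intro continuous_on_powr continuous_on_const) (auto simp: nz)
  then show ?thesis by (simp add: kernel_powr_def case_prod_unfold)
qed

lemma hyperbolic_kernel_powr_iff:
  fixes K :: "'a::topological_space \<Rightarrow> 'a \<Rightarrow> real"
  assumes "hyperbolic_kernel K"
  shows "hyperbolic_kernel (kernel_powr K s) \<longleftrightarrow>
    (\<forall>(n::nat) (x::nat \<Rightarrow> 'a). psd_on {1..n} (\<lambda>i j. K (x 0) (x i) powr s * K (x 0) (x j) powr s - K (x i) (x j) powr s))"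
  using continuous_kernel_powr[OF assms] assms
  by (auto simp: hyperbolic_kernel_iff kernel_powr_def)

lemma hyperbolic_kernel_powr:
  assumes "hyperbolic_kernel K" "0 < s" "s < 1"
  shows "hyperbolic_kernel (kernel_powr K s)"
  unfolding hyperbolic_kernel_powr_iff[OF assms(1)]
proof (intro allI psd_on_powr_defect assms(2,3) finite_atLeastAtMost hyperbolic_kernel_psd[OF assms(1)])
qed (auto intro: less_le_trans[OF zero_less_one hyperbolic_kernel_ge_1[OF assms(1)]])

lemma kernel_powr_powr: "kernel_powr (kernel_powr K t) s = kernel_powr K (t * s)"
  by (simp add: kernel_powr_def powr_powr)

text \<open>The factorisation \<open>s = t * (s / t)\<close> reduces to exponents below 1; the
  positive exponents of hyperbolic type are thus closed downwards.\<close>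

lemma hyperbolic_kernel_powr_mono:
  assumes "hyperbolic_kernel (kernel_powr K t)" "0 < s" "s \<le> t"
  shows "hyperbolic_kernel (kernel_powr K s)"
proof (cases "s = t")
  case False
  then have "hyperbolic_kernel (kernel_powr (kernel_powr K t) (s / t))"
    using assms(2,3) by (intro hyperbolic_kernel_powr[OF assms(1)]) (auto simp: divide_less_eq)
  moreover have "t * (s / t) = s" using assms(2,3) by simp
  ultimately show ?thesis by (simp only: kernel_powr_powr)
qed (use assms in simp)

text \<open>In the iterated product topology, evaluation at a pair is two projections in
  succession.\<close>

lemma tendsto_kernel_value: "((\<lambda>K. K x y) \<longlongrightarrow> K0 x y) (nhds K0)"
  for K0 :: "'a \<Rightarrow> 'a \<Rightarrow> real"
  by (rule filterlim_compose[OF tendsto_coordinate tendsto_coordinate])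

text \<open>A violation has a finite witness: a strict inequality that depends continuously on
  finitely many kernel values.\<close>

lemma eventually_not_hyperbolic_powr:
  fixes K0 :: "'a::topological_space \<Rightarrow> 'a \<Rightarrow> real"
  assumes "hyperbolic_kernel K0" "\<not> hyperbolic_kernel (kernel_powr K0 s)"
  shows "eventually (\<lambda>K. \<not> hyperbolic_kernel (kernel_powr K s)) (nhds K0)"
proof -
  define D where "D n x c K = (\<Sum>k=1..n. c k * kernel_powr K s (x 0) (x k))\<^sup>2 -
      (\<Sum>i=1..n. \<Sum>j=1..n. c i * c j * kernel_powr K s (x i) (x j))"
    for n :: nat and x :: "nat \<Rightarrow> 'a" and c :: "nat \<Rightarrow> real" and K
  \<comment> \<open>All other clauses of the definition pass to the power, so only the inequality
    can fail.\<close>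
  have "\<exists>n x c. D n x c K0 < 0"
  proof (rule ccontr)
    assume "\<nexists>n x c. D n x c K0 < 0"
    then have "0 \<le> D n x c K0" for n x c by (meson not_less)
    then have "(\<Sum>i=1..n. \<Sum>j=1..n. c i * c j * kernel_powr K0 s (x i) (x j))
        \<le> (\<Sum>k=1..n. c k * kernel_powr K0 s (x 0) (x k))\<^sup>2"
      for n :: nat and x :: "nat \<Rightarrow> 'a" and c :: "nat \<Rightarrow> real"
      unfolding D_def diff_ge_0_iff_ge .
    moreover have "continuous_on UNIV (\<lambda>(x, y). kernel_powr K0 s x y)"
      by (rule continuous_kernel_powr[OF assms(1)])
    moreover have "\<forall>x y. kernel_powr K0 s x y = kernel_powr K0 s y x" "\<forall>x y. 0 \<le> kernel_powr K0 s x y"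
      "\<forall>x. kernel_powr K0 s x x = 1"
      using assms(1) by (auto simp: hyperbolic_kernel_def kernel_powr_def)
    ultimately show False using assms(2) unfolding hyperbolic_kernel_def by simp
  qed
  then obtain n x c where neg: "D n x c K0 < 0" by blast
  have "K0 u v \<noteq> 0" for u v using hyperbolic_kernel_ge_1[OF assms(1), of u v] by linarith
  then have "((\<lambda>K. D n x c K) \<longlongrightarrow> D n x c K0) (nhds K0)"
    unfolding D_def kernel_powr_def
    by (intro tendsto_diff tendsto_power tendsto_sum tendsto_mult tendsto_const tendsto_powr
        tendsto_kernel_value) auto
  then have "eventually (\<lambda>K. D n x c K < 0) (nhds K0)" using neg by (rule order_tendstoD)
  then show ?thesis
  proof eventually_elim
    case (elim K)
    show ?case
    proof
      assume "hyperbolic_kernel (kernel_powr K s)"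
      then have "0 \<le> D n x c K"
        unfolding hyperbolic_kernel_def D_def diff_ge_0_iff_ge by (elim conjE allE)
      then show False using elim by simp
    qed
  qed
qed

text \<open>Two equal columns would give a null vector with entries 1 and -1.\<close>

lemma nondegenerate_on_offdiag:
  assumes "nondegenerate_on S A" "finite S" "i \<in> S" "j \<in> S" "i \<noteq> j"
  shows "\<exists>k\<in>S. A k i \<noteq> A k j"
proof (rule ccontr)
  assume *: "\<not> (\<exists>k\<in>S. A k i \<noteq> A k j)"
  define c where "c = (\<lambda>l. if l = i then 1 else if l = j then - 1 else 0 :: real)"
  have "(\<Sum>l\<in>S. A k l * c l) = 0" if "k \<in> S" for k
  proof -
    have "A k i = A k j" using * that by blast
    moreover have "(\<Sum>l\<in>S. A k l * c l) = (\<Sum>l\<in>{i, j}. A k l * c l)"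
      using assms by (intro sum.mono_neutral_right) (auto simp: c_def)
    ultimately show ?thesis using assms(5) by (simp add: c_def)
  qed
  then have "\<forall>l\<in>S. c l = 0"
    using assms(1) unfolding nondegenerate_on_def by blast
  then show False using assms(3) by (auto simp: c_def)
qed

text \<open>The base point is \<open>y 0\<close>. Points with kernel value 1 coincide in hyperbolic
  space and would produce equal columns, so nondegeneracy pushes all off-diagonal values above
  1.\<close>

lemma nondegenerate_on_gram_powr:
  fixes K :: "'a::topological_space \<Rightarrow> 'a \<Rightarrow> real" and y :: "nat \<Rightarrow> 'a"
  assumes "represents_kernel I f K" "finite I"
    and nd: "nondegenerate_on {..n} (\<lambda>i j. K (y i) (y j))"
    and s: "0 < s" "s < 1"
  shows "nondegenerate_on {..n} (\<lambda>i j. K (y i) (y j) powr s)"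
proof (rule nondegenerate_on_powr[where p = 0])
  note K = represents_kernel_finite(2)[OF assms(1,2)]
  have H: "f x \<in> hyp_space I" for x using represents_kernel_finite(1)[OF assms(1,2)] by auto
  show "psd_on {..n} (\<lambda>i j. K (y 0) (y i) * K (y 0) (y j) - K (y i) (y j))"
    unfolding K by (rule hyp_space_psd[OF assms(2) H])
  show "K (y i) (y i) = 1" for i using hyp_spaceD(1)[OF H] by (simp add: K)
  fix i j assume ij: "i \<in> {..n}" "j \<in> {..n}" "i \<noteq> j"
  obtain k where k: "K (y k) (y i) \<noteq> K (y k) (y j)"
    using nondegenerate_on_offdiag[OF nd _ ij] by auto
  have "K (y i) (y j) \<noteq> 1"
  proof
    assume "K (y i) (y j) = 1"
    then have "fst (f (y i)) = fst (f (y j)) \<and> (\<forall>l\<in>I. snd (f (y i)) l = snd (f (y j)) l)"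
      by (intro lorentz_form_eq_1[OF assms(2) H H]) (simp add: K)
    then have "K (y k) (y i) = K (y k) (y j)"
      using assms(2) by (simp add: K lorentz_form_finite)
    then show False using k by simp
  qed
  moreover have "1 \<le> K (y i) (y j)" unfolding K by (rule lorentz_form_ge_1[OF assms(2) H H])
  ultimately show "1 < K (y i) (y j)" by simp
qed (use s in auto)

text \<open>Openness in exponent and kernel jointly, so that compactness of an interval of exponents
  can be applied.\<close>

lemma eventually_nondegenerate_on_powr:
  fixes K0 :: "'a::topological_space \<Rightarrow> 'a \<Rightarrow> real" and y :: "nat \<Rightarrow> 'a"
  assumes "hyperbolic_kernel K0" "nondegenerate_on {..n} (\<lambda>i j. K0 (y i) (y j) powr t)"
  shows "eventually (\<lambda>(t', K). nondegenerate_on {..n} (\<lambda>i j. K (y i) (y j) powr t'))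
    (nhds t \<times>\<^sub>F nhds K0)"
  unfolding case_prod_unfold
proof (rule eventually_nondegenerate_on[OF _ assms(2)])
  fix i j
  have "K0 (y i) (y j) \<noteq> 0" using hyperbolic_kernel_ge_1[OF assms(1), of "y i" "y j"] by linarith
  then show "((\<lambda>x. snd x (y i) (y j) powr fst x) \<longlongrightarrow> K0 (y i) (y j) powr t) (nhds t \<times>\<^sub>F nhds K0)"
    by (intro tendsto_powr filterlim_fst filterlim_compose[OF tendsto_kernel_value filterlim_snd])
qed simp

section \<open>The critical exponent and the attained dimension\<close>

lemma kernel_powr_one: "hyperbolic_kernel K \<Longrightarrow> kernel_powr K 1 = K"
  by (intro ext) (simp add: kernel_powr_def hyperbolic_kernel_def)

lemma critical_exponent_ge_1:
  assumes "hyperbolic_kernel K"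
  shows "1 \<le> critical_exponent K"
  unfolding critical_exponent_def
  using assms kernel_powr_one[OF assms]
  by (intro Sup_upper) (auto simp: hyperbolic_kernels_def one_ereal_def)

lemma critical_exponent_le:
  assumes "\<not> hyperbolic_kernel (kernel_powr K s)" "0 < s"
  shows "critical_exponent K \<le> ereal s"
  unfolding critical_exponent_def
proof (rule Sup_least, clarify)
  fix t assume "1 \<le> t" "kernel_powr K t \<in> hyperbolic_kernels"
  then show "ereal t \<le> ereal s"
    using assms hyperbolic_kernel_powr_mono[of K t s] by (force simp: hyperbolic_kernels_def)
qed

lemma not_hyperbolic_above_critical_exponent:
  assumes "critical_exponent K < ereal s" "1 \<le> s"
  shows "\<not> hyperbolic_kernel (kernel_powr K s)"
proof
  assume "hyperbolic_kernel (kernel_powr K s)"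
  then have "ereal s \<le> critical_exponent K"
    unfolding critical_exponent_def using assms(2)
    by (intro Sup_upper) (auto simp: hyperbolic_kernels_def)
  then show False using assms(1) by simp
qed

text \<open>A nonempty set in \<open>enat\<close> contains its infimum; the empty set has infimum
  \<open>\<infinity>\<close>, which the hypothesis excludes.\<close>

lemma kernel_dim_attained:
  fixes K :: "'a::topological_space \<Rightarrow> 'a \<Rightarrow> real"
  assumes "kernel_dim K < \<infinity>"
  obtains I :: "('a + nat) set" and f where
    "represents_kernel I f K" "finite I" "kernel_dim K = enat (card I)"
proof -
  let ?D = "{ecard I | I :: ('a + nat) set. \<exists>f. represents_kernel I f K}"
  have "?D \<noteq> {}"
  proof
    assume "?D = {}"
    then have "kernel_dim K = \<infinity>" unfolding kernel_dim_def by (simp only: Inf_enat_def refl if_True)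
    then show False using assms by simp
  qed
  then have "Inf ?D \<in> ?D" unfolding Inf_enat_def by (metis (no_types, lifting) LeastI ex_in_conv)
  then obtain I :: "('a + nat) set" and f where *: "represents_kernel I f K" "kernel_dim K = ecard I"
    unfolding kernel_dim_def by auto
  moreover from this have "finite I" using assms by (auto simp: ecard_def split: if_splits)
  ultimately show thesis using that by (simp add: ecard_def)
qed

theorem proposition5p8:
  fixes K0 :: "'a::topological_space \<Rightarrow> 'a \<Rightarrow> real"
  assumes "K0 \<in> hyperbolic_kernels"
    and "critical_dim K0 < \<infinity>"
    and "critical_exponent K0 < \<infinity>"
  shows "lower_semicontinuous_at hyperbolic_kernels critical_dim K0"
proof -
  have K0: "hyperbolic_kernel K0" using assms(1) by (simp add: hyperbolic_kernels_def)
  define t0 where "t0 = real_of_ereal (critical_exponent K0)"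
  have e0: "critical_exponent K0 = ereal t0"
    using assms(3) critical_exponent_ge_1[OF K0] unfolding t0_def
    by (cases "critical_exponent K0") auto
  have t0: "1 \<le> t0" using critical_exponent_ge_1[OF K0] by (simp add: e0 one_ereal_def)
  define H where "H = kernel_powr K0 t0"
  have dimH: "critical_dim K0 = kernel_dim H"
    using assms(3) by (simp add: critical_dim_def H_def t0_def)
  obtain I :: "('a + nat) set" and f where
    f: "represents_kernel I f H" "finite I" "kernel_dim H = enat (card I)"
    using kernel_dim_attained assms(2) unfolding dimH by blast
  define d where "d = card I"
  obtain y :: "nat \<Rightarrow> 'a" where "nondegenerate_on {..d} (\<lambda>i j. lorentz_form I (f (y i)) (f (y j)))"
    using hyp_total_nondegenerate[OF f(2) _ represents_kernel_finite(1)[OF f(1,2)]] f(1)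
    unfolding represents_kernel_def d_def by blast
  then have nd0: "nondegenerate_on {..d} (\<lambda>i j. H (y i) (y j))"
    by (simp add: represents_kernel_finite(2)[OF f(1,2)])
  let ?N = "\<lambda>t K. nondegenerate_on {..d} (\<lambda>i j. K (y i) (y j) powr t)"
  have nd: "?N t K0" if "1 \<le> t" "t \<le> t0" for t
  proof (cases "t = t0")
    case True
    then show ?thesis using nd0 by (simp add: H_def kernel_powr_def)
  next
    case False
    then have "nondegenerate_on {..d} (\<lambda>i j. H (y i) (y j) powr (t / t0))"
      using that t0 by (intro nondegenerate_on_gram_powr[OF f(1,2) nd0]) auto
    then show ?thesis using t0 by (simp add: H_def kernel_powr_def powr_powr)
  qed
  \<comment> \<open>Specialising the joint neighbourhood to \<open>K0\<close> carries nondegeneracy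
    slightly beyond \<open>t0\<close>.\<close>
  have "eventually (\<lambda>t. ?N t K0) (nhds t0)"
  proof -
    obtain P Q where "eventually P (nhds t0)" "eventually Q (nhds K0)"
      and PQ: "\<And>t K. P t \<Longrightarrow> Q K \<Longrightarrow> ?N t K"
      using eventually_nondegenerate_on_powr[OF K0 nd[OF t0 order_refl]]
      unfolding eventually_prod_filter by auto
    then show ?thesis using eventually_nhds_x_imp_x[of Q K0] by (auto elim: eventually_mono)
  qed
  then obtain e where e: "0 < e" "\<And>t. dist t t0 < e \<Longrightarrow> ?N t K0"
    unfolding eventually_nhds_metric by blast
  \<comment> \<open>Half of \<open>e\<close> keeps the exponents from \<open>t0\<close> to
    \<open>s\<close> inside the ball, while \<open>s > t0\<close> makes the power of
    \<open>K0\<close> leave hyperbolic type.\<close>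
  define s where "s = t0 + e / 2"
  have s: "t0 < s" "1 \<le> s" using e(1) t0 by (auto simp: s_def)
  have nds: "?N t K0" if "t \<in> {1..s}" for t
  proof (cases "t \<le> t0")
    case False
    then have "dist t t0 < e" using that e(1) by (simp add: dist_real_def s_def)
    then show ?thesis by (rule e(2))
  qed (use that nd in auto)
  \<comment> \<open>One neighbourhood serves all exponents at once, since the critical exponent of
    \<open>K\<close> may lie anywhere in \<open>{1..s}\<close>.\<close>
  have "eventually (\<lambda>K. \<forall>t\<in>{1..s}. ?N t K) (nhds K0)"
    by (rule eventually_ball_compact) (auto intro!: eventually_nondegenerate_on_powr K0 nds)
  moreover have "eventually (\<lambda>K. \<not> hyperbolic_kernel (kernel_powr K s)) (nhds K0)"
    using s e0 by (intro eventually_not_hyperbolic_powr K0 not_hyperbolic_above_critical_exponent) auto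
  ultimately have "eventually (\<lambda>K. K \<in> hyperbolic_kernels \<longrightarrow> critical_dim K0 \<le> critical_dim K) (nhds K0)"
  proof eventually_elim
    case (elim K)
    show ?case
    proof
      assume "K \<in> hyperbolic_kernels"
      then have K: "1 \<le> critical_exponent K"
        by (intro critical_exponent_ge_1) (simp add: hyperbolic_kernels_def)
      have le: "critical_exponent K \<le> ereal s"
        using elim(2) s by (intro critical_exponent_le) auto
      \<comment> \<open>The bound by \<open>s\<close> excludes the value \<open>\<infinity>\<close>,
        so the first branch of \<open>critical_dim\<close> applies to \<open>K\<close>.\<close>
      define t where "t = real_of_ereal (critical_exponent K)"
      have t: "critical_exponent K = ereal t"
        using K le unfolding t_def by (cases "critical_exponent K") auto
      then have "t \<in> {1..s}" using K le by (simp add: one_ereal_def)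
      then have "?N t K" using elim(1) by blast
      then have "enat d \<le> kernel_dim (kernel_powr K t)"
        by (intro kernel_dim_ge) (simp add: kernel_powr_def)
      moreover have "critical_dim K = kernel_dim (kernel_powr K t)"
        by (simp add: critical_dim_def t)
      ultimately show "critical_dim K0 \<le> critical_dim K"
        by (simp only: dimH f(3) d_def)
    qed
  qed
  then show ?thesis
    unfolding lower_semicontinuous_at_def eventually_at_filter
    by (auto elim!: eventually_mono intro: less_le_trans)
qed

end
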